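(* Let $\mathcal R$ be an aperiodic p.m.p. equivalence relation on a standard probability space $(X,\mu)$. Let $\mathcal S\in\mathrm{Sub}(\mathcal R)$ be a subequivalence relation. The following are equivalent: (i) $\mathcal S$ has everywhere infinite index in $\mathcal R$; (ii) the closure (in $\mathrm{Sub}(\mathcal R)$) of the $[\mathcal R]$-orbit of $\mathcal S$ contains $\Delta_X=\{(x,x):x\in X\}$; (iii) the closure (in $\mathrm{Sub}(\mathcal R)$) of the $\mathrm{Aut}(\mathcal R)$-orbit of $\mathcal S$ contains $\Delta_X$.
   Context: Standard probability spaces are atomless. A p.m.p. equivalence relation $\mathcal R$ on $(X,\mu)$ is the orbit equivalence relation of a measure-preserving Borel action of a countable group on $(X,\mu)$; it is aperiodic if almost all its classes are infinite. Everything is considered up to null sets. Equip $\mathcal R$ with the measure $M(A)=\int_X|A_x|\,d\mu(x)$, where $A_x=\{y:(x,y)\in A\}$; $\mathrm{MAlg}(\mathcal R,M)$ is the space of Borel subsets of $\mathcal R$ modulo $M$-null sets with the topology of the metric $d_m(A,B)=m(A\triangle B)$, for $m$ any finite measure equivalent to $M$ (the topology does not depend on $m$). $\mathrm{Sub}(\mathcal R)\subseteq\mathrm{MAlg}(\mathcal R,M)$ is the subspace of (classes of) Borel equivalence relations on $X$ contained in $\mathcal R$. $\mathrm{Aut}(\mathcal R)$ is the group of all measure-preserving automorphisms $T$ of $(X,\mu)$ (mod null sets) such that $(T\times T)(\mathcal R)=\mathcal R$ up to null sets, and the full group $[\mathcal R]\leq\mathrm{Aut}(\mathcal R)$ consists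 of those $T$ with $(x,T(x))\in\mathcal R$ for almost every $x$. These act on $\mathrm{Sub}(\mathcal R)$ by $T\cdot\mathcal S=(T\times T)(\mathcal S)$. $\mathcal S$ has everywhere infinite index in $\mathcal R$ if for every Borel $A\subseteq X$ with $\mu(A)>0$, for almost every $x\in A$ the $\mathcal R_{\restriction A}$-class of $x$ contains infinitely many distinct $\mathcal S_{\restriction A}$-classes, where $\mathcal R_{\restriction A}=\mathcal R\cap(A\times A)$. *)

theory Defs
  imports "HOL-Probability.Probability" "HOL-Algebra.Group_Action"
begin

section \<open>Probability measure preserving equivalence relations\<close>

definition atomless :: "'a measure \<Rightarrow> bool" where
  "atomless \<mu> \<longleftrightarrow>
    (\<forall>A\<in>sets \<mu>. 0 < emeasure \<mu> A \<longrightarrow>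
      (\<exists>B\<in>sets \<mu>. B \<subseteq> A \<and> 0 < emeasure \<mu> B \<and> emeasure \<mu> B < emeasure \<mu> A))"

definition standard_prob_space :: "'a::polish_space measure \<Rightarrow> bool" where
  "standard_prob_space \<mu> \<longleftrightarrow> sets \<mu> = sets borel \<and> prob_space \<mu> \<and> atomless \<mu>"

text \<open>
  Every countable group is isomorphic to one whose carrier is a set of natural numbers, so
  quantifying over groups on \<^typ>\<open>nat\<close> covers all countable groups.
  The relation need not be assumed Borel: it is a countable union of graphs of Borel maps.
\<close>

definition pmp_equiv_rel :: "'a::polish_space measure \<Rightarrow> ('a \<times> 'a) set \<Rightarrow> bool" where
  "pmp_equiv_rel \<mu> R \<longleftrightarrow>
    (\<exists>(G :: nat monoid) \<phi>. group_action G (UNIV :: 'a set) \<phi> \<and>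
      (\<forall>g\<in>carrier G. \<phi> g \<in> measurable \<mu> \<mu> \<and> distr \<mu> \<mu> (\<phi> g) = \<mu>) \<and>
      R = {(x, y). y \<in> orbit G \<phi> x})"

definition aperiodic :: "'a measure \<Rightarrow> ('a \<times> 'a) set \<Rightarrow> bool" where
  "aperiodic \<mu> R \<longleftrightarrow> (AE x in \<mu>. infinite (R `` {x}))"

definition Borel_subrel :: "'a measure \<Rightarrow> ('a \<times> 'a) set \<Rightarrow> ('a \<times> 'a) set \<Rightarrow> bool" where
  "Borel_subrel \<mu> R S \<longleftrightarrow> equiv UNIV S \<and> S \<in> sets (\<mu> \<Otimes>\<^sub>M \<mu>) \<and> S \<subseteq> R"

text \<open>
  \<^term>\<open>(Restr R A `` {x}) // Restr S A\<close> is the set of all \<open>S\<restriction>A\<close>-classes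
  contained in the \<open>R\<restriction>A\<close>-class of \<^term>\<open>x\<close>.
\<close>

definition everywhere_infinite_index ::
  "'a measure \<Rightarrow> ('a \<times> 'a) set \<Rightarrow> ('a \<times> 'a) set \<Rightarrow> bool" where
  "everywhere_infinite_index \<mu> R S \<longleftrightarrow>
    (\<forall>A\<in>sets \<mu>. 0 < emeasure \<mu> A \<longrightarrow>
      (AE x in \<mu>. x \<in> A \<longrightarrow> infinite ((Restr R A `` {x}) // Restr S A)))"


section \<open>The measure on a relation and its measure algebra\<close>

definition section_integral :: "'a measure \<Rightarrow> ('a \<times> 'a) set \<Rightarrow> ennreal" where
  "section_integral \<mu> A = (\<integral>\<^sup>+ x. emeasure (count_space UNIV) (A `` {x}) \<partial>\<mu>)"

definition rel_measure :: "'a measure \<Rightarrow> ('a \<times> 'a) set \<Rightarrow> ('a \<times> 'a) measure" where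
  "rel_measure \<mu> R =
    measure_of R (sets (restrict_space (\<mu> \<Otimes>\<^sub>M \<mu>) R)) (section_integral \<mu>)"

definition null_rel :: "'b measure \<Rightarrow> ('b set \<times> 'b set) set" where
  "null_rel N = {(A, B). A \<in> sets N \<and> B \<in> sets N \<and> sym_diff A B \<in> null_sets N}"

definition MAlg :: "'b measure \<Rightarrow> 'b set set set" where
  "MAlg N = sets N // null_rel N"

definition mclass :: "'b measure \<Rightarrow> 'b set \<Rightarrow> 'b set set" where
  "mclass N A = null_rel N `` {A}"

text \<open>
  If \<open>m\<close> is equivalent to \<open>N\<close>, the value below does not depend on the
  representatives chosen from the classes \<open>P\<close> and \<open>Q\<close>.
\<close>

definition MAlg_dist :: "'b measure \<Rightarrow> 'b set set \<Rightarrow> 'b set set \<Rightarrow> real" where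
  "MAlg_dist m P Q = measure m (sym_diff (SOME A. A \<in> P) (SOME B. B \<in> Q))"

definition equivalent_measures :: "'b measure \<Rightarrow> 'b measure \<Rightarrow> bool" where
  "equivalent_measures m N \<longleftrightarrow>
    sets m = sets N \<and> absolutely_continuous m N \<and> absolutely_continuous N m"

lemma equiv_null_rel: "equiv (sets N) (null_rel N)"
proof (rule equivI)
  show "trans (null_rel N)"
  proof (rule transI)
    fix A B C assume *: "(A, B) \<in> null_rel N" "(B, C) \<in> null_rel N"
    then have "sym_diff A B \<union> sym_diff B C \<in> null_sets N"
      by (auto simp: null_rel_def)
    moreover have "sym_diff A C \<in> sets N"
      using * by (auto simp: null_rel_def)
    ultimately have "sym_diff A C \<in> null_sets N"
      by (rule null_sets_subset) auto
    with * show "(A, C) \<in> null_rel N"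
      by (auto simp: null_rel_def)
  qed
qed (auto simp: null_rel_def refl_on_def sym_def Un_commute)

lemma MAlg_dist_mclass:
  assumes m: "finite_measure m" "equivalent_measures m N"
    and A: "A \<in> sets N" and B: "B \<in> sets N"
  shows "MAlg_dist m (mclass N A) (mclass N B) = measure m (sym_diff A B)"
proof -
  interpret finite_measure m by fact
  have S: "sets m = sets N" and null: "null_sets N \<subseteq> null_sets m"
    using m(2) by (auto simp: equivalent_measures_def absolutely_continuous_def)
  define A' where "A' = (SOME X. X \<in> mclass N A)"
  define B' where "B' = (SOME X. X \<in> mclass N B)"
  have "(A, A) \<in> null_rel N" "(B, B) \<in> null_rel N"
    using A B by (auto simp: null_rel_def)
  then have "A' \<in> mclass N A" "B' \<in> mclass N B"
    unfolding A'_def B'_def mclass_def by (metis Image_singleton_iff someI)+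
  then have *: "A' \<in> sets m" "B' \<in> sets m" "sym_diff A A' \<in> null_sets m"
      "sym_diff B B' \<in> null_sets m"
    using null S by (auto simp: mclass_def null_rel_def)
  have "AE x in m. x \<in> sym_diff A' B' \<longleftrightarrow> x \<in> sym_diff A B"
    using *(3,4)[THEN AE_not_in] by eventually_elim auto
  then have "measure m (sym_diff A' B') = measure m (sym_diff A B)"
    using * A B S by (intro finite_measure_eq_AE) auto
  then show ?thesis
    by (simp add: MAlg_dist_def A'_def B'_def)
qed

lemma Metric_space_MAlg:
  assumes m: "finite_measure m" "equivalent_measures m N"
  shows "Metric_space (MAlg N) (MAlg_dist m)"
proof
  interpret finite_measure m by fact
  have S: "sets m = sets N" and null: "null_sets m \<subseteq> null_sets N"
    using m(2) by (auto simp: equivalent_measures_def absolutely_continuous_def)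
  note d = MAlg_dist_mclass[OF m]
  have rep: "\<exists>A\<in>sets N. P = mclass N A" if "P \<in> MAlg N" for P
    using that by (auto simp: MAlg_def mclass_def quotient_def)
  fix P Q
  show "0 \<le> MAlg_dist m P Q"
    by (simp add: MAlg_dist_def)
  show "MAlg_dist m P Q = MAlg_dist m Q P"
    by (simp add: MAlg_dist_def Un_commute)
  assume PQ: "P \<in> MAlg N" "Q \<in> MAlg N"
  from PQ[THEN rep] obtain A B where AB: "A \<in> sets N" "B \<in> sets N"
      "P = mclass N A" "Q = mclass N B" by blast
  show "MAlg_dist m P Q = 0 \<longleftrightarrow> P = Q"
  proof
    assume "MAlg_dist m P Q = 0"
    then have "sym_diff A B \<in> null_sets N"
      using AB S null by (auto simp: d emeasure_eq_measure null_sets_def subset_iff)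
    with AB have "(A, B) \<in> null_rel N" by (auto simp: null_rel_def)
    with AB show "P = Q"
      unfolding mclass_def using equiv_class_eq[OF equiv_null_rel] by blast
  qed (use AB d in simp)
  fix W assume "W \<in> MAlg N"
  from rep[OF this] obtain C where C: "C \<in> sets N" "W = mclass N C" by blast
  have "measure m (sym_diff A C) \<le> measure m (sym_diff A B \<union> sym_diff B C)"
    using AB C S by (intro finite_measure_mono) auto
  also have "\<dots> \<le> measure m (sym_diff A B) + measure m (sym_diff B C)"
    using AB C S by (intro measure_Un_le) auto
  finally show "MAlg_dist m P W \<le> MAlg_dist m P Q + MAlg_dist m Q W"
    using AB C by (simp add: d)
qed


section \<open>The space of subrelations and the automorphisms acting on it\<close>

definition Sub :: "'a measure \<Rightarrow> ('a \<times> 'a) set \<Rightarrow> ('a \<times> 'a) set set set" where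
  "Sub \<mu> R = {mclass (rel_measure \<mu> R) S | S. Borel_subrel \<mu> R S}"

definition Sub_topology ::
  "'a measure \<Rightarrow> ('a \<times> 'a) set \<Rightarrow> ('a \<times> 'a) measure \<Rightarrow> ('a \<times> 'a) set set topology" where
  "Sub_topology \<mu> R m =
    subtopology (Metric_space.mtopology (MAlg (rel_measure \<mu> R)) (MAlg_dist m)) (Sub \<mu> R)"

text \<open>
  Automorphisms are represented by everywhere defined Borel bijections. On an atomless standard
  probability space every measure-preserving automorphism modulo null sets has such a
  representative, and the class of the image of a relation depends only on the automorphism
  modulo null sets.
  The term \<open>inv_into UNIV T\<close> is the inverse function, written out because \<open>inv\<close>
  is also the syntax of group inverses.
\<close>

definition Aut_space :: "'a measure \<Rightarrow> ('a \<Rightarrow> 'a) set" where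
  "Aut_space \<mu> =
    {T. bij T \<and> T \<in> measurable \<mu> \<mu> \<and> inv_into UNIV T \<in> measurable \<mu> \<mu> \<and> distr \<mu> \<mu> T = \<mu>}"

definition Aut_rel :: "'a measure \<Rightarrow> ('a \<times> 'a) set \<Rightarrow> ('a \<Rightarrow> 'a) set" where
  "Aut_rel \<mu> R = {T \<in> Aut_space \<mu>. section_integral \<mu> (sym_diff (map_prod T T ` R) R) = 0}"

definition full_group :: "'a measure \<Rightarrow> ('a \<times> 'a) set \<Rightarrow> ('a \<Rightarrow> 'a) set" where
  "full_group \<mu> R = {T \<in> Aut_rel \<mu> R. AE x in \<mu>. (x, T x) \<in> R}"

text \<open>
  Since \<open>T\<close> preserves \<open>R\<close> only up to null sets, the image of \<open>S\<close> is intersected with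
  \<open>R\<close> to obtain a representative that is a subset of \<open>R\<close>.
\<close>

definition rel_orbit ::
  "'a measure \<Rightarrow> ('a \<times> 'a) set \<Rightarrow> ('a \<Rightarrow> 'a) set \<Rightarrow> ('a \<times> 'a) set \<Rightarrow> ('a \<times> 'a) set set set" where
  "rel_orbit \<mu> R \<Gamma> S = {mclass (rel_measure \<mu> R) (map_prod T T ` S \<inter> R) | T. T \<in> \<Gamma>}"

end

theory Submission
  imports Defs
begin

text \<open>
  If \<open>S\<close> has everywhere infinite index and \<open>F\<close> is a finite symmetric set of group elements, a maximal
  partial injection \<open>U\<close> with graph in \<open>R\<close> sending \<open>x\<close> and \<open>h x\<close> (\<open>h \<in> F\<close>, \<open>h x \<noteq> x\<close>) to
  \<open>S\<close>-inequivalent points is defined almost everywhere: for \<open>x\<close> outside the domain, every point of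
  the class of \<open>x\<close> outside the range is \<open>S\<close>-equivalent to one of the finitely many points \<open>U (h x)\<close>,
  so the part of the complement of the range in these classes is null, and then so is the complement
  of the domain because \<open>U\<close> preserves measure on invariant sets. The inverse of \<open>U\<close> moves \<open>S\<close> off all
  graphs of elements of \<open>F\<close>, apart from the diagonal; let \<open>F\<close> exhaust the group.

  Conversely, if the index is at most \<open>k\<close> on a set \<open>C\<close> of positive measure, then for a large finite
  \<open>F\<close> the set \<open>F x \<inter> T C\<close> has more than \<open>k\<close> points with probability bounded below uniformly in the
  automorphism \<open>T\<close>. Two of these points are equivalent for the image of \<open>S\<close> under \<open>T\<close>, which
  therefore stays away from the diagonal.
\<close>

section \<open>Absolute continuity of finite measures\<close>

text \<open>Borel-Cantelli: sets of \<open>M\<close>-measure below \<open>(1/2)^n\<close> and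
  \<open>N\<close>-measure at least \<open>e\<close> would have an \<open>M\<close>-null limsup of
  \<open>N\<close>-measure at least \<open>e\<close>. The eventuality form lets finitely many
  \<open>N\<close> share one \<open>d\<close>.\<close>

lemma absolutely_continuous_eventually_small:
  assumes "finite_measure M" "finite_measure N" and sets: "sets N = sets M"
    and ac: "absolutely_continuous M N" and "0 < e"
  shows "\<forall>\<^sub>F d in at_right (0::real). \<forall>A\<in>sets M. measure M A < d \<longrightarrow> measure N A < e"
proof -
  interpret M: finite_measure M by fact
  interpret N: finite_measure N by fact
  have "\<exists>n. \<forall>A\<in>sets M. measure M A < (1/2)^n \<longrightarrow> measure N A < e"
  proof (rule ccontr)
    assume "\<not> ?thesis"
    then have "\<forall>n. \<exists>A\<in>sets M. measure M A < (1/2)^n \<and> e \<le> measure N A"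
      by (meson not_less)
    then obtain A where A[measurable]: "\<And>n. A n \<in> sets M"
      and M: "\<And>n. measure M (A n) < (1/2)^n" and N: "\<And>n. e \<le> measure N (A n)"
      by metis
    have [measurable]: "\<And>n. A n \<in> sets N" using A sets by simp
    have "summable (\<lambda>n. measure M (A n))"
      by (rule summable_comparison_test'[OF summable_geometric, of "1/2" 0]) (auto intro: less_imp_le[OF M])
    then have "limsup A \<in> null_sets M"
      by (intro borel_cantelli_limsup1) (auto simp: M.emeasure_eq_measure)
    then have "limsup A \<in> null_sets N"
      using ac by (auto simp: absolutely_continuous_def)
    then have 0: "measure N (limsup A) = 0"
      by (simp add: measure_eq_emeasure_eq_ennreal null_setsD1)
    have "(\<lambda>k. measure N (\<Union>n\<in>{k..}. A n)) \<longlonglongrightarrow> measure N (\<Inter>k. \<Union>n\<in>{k..}. A n)"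
    proof (rule N.finite_Lim_measure_decseq)
      show "decseq (\<lambda>k. \<Union>n\<in>{k..}. A n)"
        by (intro decseq_SucI UN_mono) auto
    qed auto
    moreover have "e \<le> measure N (\<Union>n\<in>{k..}. A n)" for k
      by (rule order_trans[OF N[of k]]) (intro N.finite_measure_mono, auto)
    ultimately have "e \<le> measure N (\<Inter>k. \<Union>n\<in>{k..}. A n)"
      by (intro LIMSEQ_le_const) auto
    with 0 \<open>0 < e\<close> show False
      by (simp add: limsup_INF_SUP)
  qed
  then obtain n where "\<forall>A\<in>sets M. measure M A < (1/2)^n \<longrightarrow> measure N A < e" ..
  then show ?thesis
    unfolding eventually_at_right_field
    by (intro exI[of _ "(1/2)^n"]) (auto intro: less_trans)
qed

section \<open>Orbit relations of countable measure-preserving actions\<close>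

locale pmp_action = prob_space \<mu> + group_action G "UNIV :: 'a set" \<phi>
  for \<mu> :: "'a::polish_space measure" and G :: "nat monoid" (structure) and \<phi> +
  assumes sets_eq_borel: "sets \<mu> = sets borel"
    and measurable_act: "g \<in> carrier G \<Longrightarrow> \<phi> g \<in> measurable \<mu> \<mu>"
    and distr_act: "g \<in> carrier G \<Longrightarrow> distr \<mu> \<mu> (\<phi> g) = \<mu>"
begin

sublocale group G
  using group_hom group_hom.axioms(1) by auto

definition R :: "('a \<times> 'a) set" where
  "R = {(x, y). y \<in> orbit G \<phi> x}"

section \<open>Algebra of the action and its orbit relation\<close>

lemma space_eq [simp]: "space \<mu> = UNIV"
  using sets_eq_imp_space_eq[OF sets_eq_borel] by simp

lemma act_one [simp]: "\<phi> \<one> x = x"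
  using id_eq_one by (metis UNIV_I restrict_apply')

lemma act_mult: "g \<in> carrier G \<Longrightarrow> h \<in> carrier G \<Longrightarrow> \<phi> (g \<otimes> h) x = \<phi> g (\<phi> h x)"
  by (simp add: composition_rule)

lemma act_inv_act [simp]: "g \<in> carrier G \<Longrightarrow> \<phi> (inv g) (\<phi> g x) = x"
  using orbit_sym_aux by blast

lemma act_act_inv [simp]: "g \<in> carrier G \<Longrightarrow> \<phi> g (\<phi> (inv g) x) = x"
  using act_inv_act[of "inv g" x] by simp

lemma act_eq_iff [simp]: "g \<in> carrier G \<Longrightarrow> \<phi> g x = \<phi> g y \<longleftrightarrow> x = y"
  by (metis act_inv_act)

lemma act_image_eq_vimage: "g \<in> carrier G \<Longrightarrow> \<phi> g ` A = \<phi> (inv g) -` A"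
  by (auto simp: image_iff) (metis act_act_inv)

lemma mem_R_iff: "(x, y) \<in> R \<longleftrightarrow> (\<exists>g\<in>carrier G. y = \<phi> g x)"
  by (auto simp: R_def orbit_def)

lemma act_mem_R: "g \<in> carrier G \<Longrightarrow> (x, \<phi> g x) \<in> R"
  by (auto simp: mem_R_iff)

lemma equiv_R: "equiv UNIV R"
proof (rule equivI)
  show "refl R"
    unfolding refl_on_def mem_R_iff by (auto intro!: bexI[of _ \<one>])
  show "sym R"
    unfolding sym_def mem_R_iff by (auto intro!: bexI[OF _ inv_closed])
  show "trans R"
    unfolding trans_def mem_R_iff by (auto simp: act_mult[symmetric])
qed auto

lemma R_refl: "(x, x) \<in> R" and R_sym: "(x, y) \<in> R \<Longrightarrow> (y, x) \<in> R"
  and R_trans: "(x, y) \<in> R \<Longrightarrow> (y, z) \<in> R \<Longrightarrow> (x, z) \<in> R"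
  using equiv_R by (auto simp: equiv_def refl_on_def dest: symD transD)

lemma act_act_mem_R: "g \<in> carrier G \<Longrightarrow> h \<in> carrier G \<Longrightarrow> (\<phi> g x, \<phi> h x) \<in> R"
  by (rule R_trans[OF R_sym[OF act_mem_R] act_mem_R])

section \<open>Borel sets attached to the action\<close>

lemma measurable_vimage: "f \<in> measurable \<mu> \<mu> \<Longrightarrow> A \<in> sets \<mu> \<Longrightarrow> f -` A \<in> sets \<mu>"
  using measurable_sets[of f \<mu> \<mu> A] by simp

lemma act_image_sets: "g \<in> carrier G \<Longrightarrow> A \<in> sets \<mu> \<Longrightarrow> \<phi> g ` A \<in> sets \<mu>"
  by (simp add: act_image_eq_vimage measurable_vimage measurable_act)

lemma emeasure_act_vimage: "g \<in> carrier G \<Longrightarrow> A \<in> sets \<mu> \<Longrightarrow> emeasure \<mu> (\<phi> g -` A) = emeasure \<mu> A"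
  using emeasure_distr[OF measurable_act, of g A] by (simp add: distr_act)

lemma emeasure_act_image: "g \<in> carrier G \<Longrightarrow> A \<in> sets \<mu> \<Longrightarrow> emeasure \<mu> (\<phi> g ` A) = emeasure \<mu> A"
  by (simp add: act_image_eq_vimage emeasure_act_vimage)

lemma AE_act: "g \<in> carrier G \<Longrightarrow> AE x in \<mu>. P x \<Longrightarrow> AE x in \<mu>. P (\<phi> g x)"
  by (rule AE_distrD[OF measurable_act]) (simp_all only: distr_act)

lemma measurable_eq_set:
  assumes "f \<in> measurable \<mu> \<mu>" "g \<in> measurable \<mu> \<mu>"
  shows "{x. f x = g x} \<in> sets \<mu>"
  using measurable_equality_set[of f \<mu> g] assms
  by (simp add: measurable_cong_sets[OF refl sets_eq_borel])

lemma rel_vimage_sets: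
  assumes "K \<in> sets (\<mu> \<Otimes>\<^sub>M \<mu>)" "f \<in> measurable \<mu> \<mu>" "g \<in> measurable \<mu> \<mu>"
  shows "{x. (f x, g x) \<in> K} \<in> sets \<mu>"
  using measurable_sets[OF measurable_Pair[OF assms(2,3)] assms(1)] by (simp add: vimage_def)

lemma map_prod_vimage_sets:
  assumes "K \<in> sets (\<mu> \<Otimes>\<^sub>M \<mu>)" "f \<in> measurable \<mu> \<mu>"
  shows "map_prod f f -` K \<in> sets (\<mu> \<Otimes>\<^sub>M \<mu>)"
proof -
  have "(\<lambda>p. (f (fst p), f (snd p))) \<in> measurable (\<mu> \<Otimes>\<^sub>M \<mu>) (\<mu> \<Otimes>\<^sub>M \<mu>)"
    using assms(2) by measurable
  from measurable_sets[OF this assms(1)] show ?thesis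
    by (simp add: vimage_def space_pair_measure map_prod_def split_beta)
qed

lemma Id_sets: "Id \<in> sets (\<mu> \<Otimes>\<^sub>M \<mu>)"
proof -
  have "Id \<in> sets (borel :: ('a \<times> 'a) measure)"
    using closed_diagonal[where 'a = 'a] by (simp add: Id_def)
  then show ?thesis
    unfolding sets_pair_measure_cong[OF sets_eq_borel sets_eq_borel] borel_prod .
qed

lemma graph_sets: "f \<in> measurable \<mu> \<mu> \<Longrightarrow> {(x, y). y = f x} \<in> sets (\<mu> \<Otimes>\<^sub>M \<mu>)"
proof -
  assume f: "f \<in> measurable \<mu> \<mu>"
  have "(\<lambda>p. (f (fst p), snd p)) \<in> measurable (\<mu> \<Otimes>\<^sub>M \<mu>) (\<mu> \<Otimes>\<^sub>M \<mu>)"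
    using f by measurable
  from measurable_sets[OF this Id_sets]
  have "{p. f (fst p) = snd p} \<in> sets (\<mu> \<Otimes>\<^sub>M \<mu>)"
    by (simp add: vimage_def space_pair_measure)
  also have "{p. f (fst p) = snd p} = {(x, y). y = f x}" by auto
  finally show ?thesis .
qed

lemma R_sets: "R \<in> sets (\<mu> \<Otimes>\<^sub>M \<mu>)"
proof -
  have "R = (\<Union>g\<in>carrier G. {(x, y). y = \<phi> g x})"
    by (auto simp: mem_R_iff)
  then show ?thesis
    using graph_sets[OF measurable_act] by (auto intro!: sets.countable_UN')
qed

section \<open>The counting measure carried by the relation\<close>

abbreviation "MR \<equiv> rel_measure \<mu> R"

text \<open>The sets \<open>first g\<close> select one index for each point of an orbit: every \<open>y\<close> in the orbit of
  \<open>x\<close> is \<open>\<phi> g x\<close> for exactly one \<open>g\<close> with \<open>x \<in> first g\<close>.\<close>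

definition first :: "nat \<Rightarrow> 'a set" where
  "first g = {x. \<forall>j\<in>carrier G. j < g \<longrightarrow> \<phi> j x \<noteq> \<phi> g x}"

lemma first_sets [measurable]: "g \<in> carrier G \<Longrightarrow> first g \<in> sets \<mu>"
proof -
  assume g: "g \<in> carrier G"
  have "first g = - (\<Union>j\<in>carrier G \<inter> {..<g}. {x. \<phi> j x = \<phi> g x})"
    by (auto simp: first_def)
  moreover have "(\<Union>j\<in>carrier G \<inter> {..<g}. {x. \<phi> j x = \<phi> g x}) \<in> sets \<mu>"
    using g by (intro sets.finite_UN measurable_eq_set measurable_act) auto
  ultimately show ?thesis
    using sets.compl_sets[of _ \<mu>] by (simp add: Compl_eq_Diff_UNIV)
qed

lemma first_exists:
  assumes "(x, y) \<in> R" obtains g where "g \<in> carrier G" "x \<in> first g" "y = \<phi> g x"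
proof -
  define g where "g = (LEAST g. g \<in> carrier G \<and> y = \<phi> g x)"
  have "\<exists>g. g \<in> carrier G \<and> y = \<phi> g x"
    using assms by (auto simp: mem_R_iff)
  from LeastI_ex[OF this] have g: "g \<in> carrier G" "y = \<phi> g x"
    by (auto simp: g_def)
  have "\<not> (j \<in> carrier G \<and> y = \<phi> j x)" if "j < g" for j
    using that unfolding g_def by (rule not_less_Least)
  with g have "x \<in> first g"
    unfolding first_def by fastforce
  with g that show thesis by blast
qed

lemma first_unique:
  assumes "g \<in> carrier G" "h \<in> carrier G" "x \<in> first g" "x \<in> first h" "\<phi> g x = \<phi> h x"
  shows "g = h"
  using assms unfolding first_def by (cases g h rule: linorder_cases) force+

lemma sets_rel_measure: "sets MR = {K. K \<in> sets (\<mu> \<Otimes>\<^sub>M \<mu>) \<and> K \<subseteq> R}"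
proof -
  have "sets MR = sets (restrict_space (\<mu> \<Otimes>\<^sub>M \<mu>) R)"
    unfolding rel_measure_def
    using sets.sigma_sets_eq[of "restrict_space (\<mu> \<Otimes>\<^sub>M \<mu>) R"]
      sets.space_closed[of "restrict_space (\<mu> \<Otimes>\<^sub>M \<mu>) R"]
    by (subst sets_measure_of) (auto simp: space_restrict_space space_pair_measure)
  also have "\<dots> = {K. K \<in> sets (\<mu> \<Otimes>\<^sub>M \<mu>) \<and> K \<subseteq> R}"
    using R_sets by (auto simp: sets_restrict_space_iff space_pair_measure)
  finally show ?thesis .
qed

text \<open>Splitting a section into disjoint pieces with at most one point, indexed through
  \<open>first\<close>, turns its cardinality into a countable sum of indicators, whose
  measurability is then visible.\<close>

lemma emeasure_section:
  assumes "K \<subseteq> R"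
  shows "emeasure (count_space UNIV) (K `` {x}) =
    (\<Sum>g. indicator {x. g \<in> carrier G \<and> x \<in> first g \<and> (x, \<phi> g x) \<in> K} x)"
proof -
  define B where "B g = {y. g \<in> carrier G \<and> x \<in> first g \<and> (x, \<phi> g x) \<in> K \<and> y = \<phi> g x}" for g
  have "K `` {x} = (\<Union>g. B g)"
  proof (intro equalityI subsetI)
    fix y assume "y \<in> K `` {x}"
    then have xy: "(x, y) \<in> K" by simp
    with assms have "(x, y) \<in> R" by blast
    then show "y \<in> (\<Union>g. B g)"
      by (rule first_exists) (use xy in \<open>auto simp: B_def\<close>)
  qed (auto simp: B_def)
  moreover have "disjoint_family B"
    unfolding B_def disjoint_family_on_def using first_unique by blast
  ultimately have "emeasure (count_space UNIV) (K `` {x}) = (\<Sum>g. emeasure (count_space UNIV) (B g))"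
    by (simp add: suminf_emeasure)
  moreover have "emeasure (count_space UNIV) (B g) =
    indicator {x. g \<in> carrier G \<and> x \<in> first g \<and> (x, \<phi> g x) \<in> K} x" for g
    by (cases "g \<in> carrier G \<and> x \<in> first g \<and> (x, \<phi> g x) \<in> K") (auto simp: B_def emeasure_count_space)
  ultimately show ?thesis by simp
qed

lemma measurable_section:
  assumes "K \<in> sets MR"
  shows "(\<lambda>x. emeasure (count_space UNIV) (K `` {x})) \<in> borel_measurable \<mu>"
proof -
  have K: "K \<subseteq> R" "K \<in> sets (\<mu> \<Otimes>\<^sub>M \<mu>)" using assms by (auto simp: sets_rel_measure)
  have "{x. g \<in> carrier G \<and> x \<in> first g \<and> (x, \<phi> g x) \<in> K} \<in> sets \<mu>" for g
  proof (cases "g \<in> carrier G")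
    case True
    have "{x. g \<in> carrier G \<and> x \<in> first g \<and> (x, \<phi> g x) \<in> K} = first g \<inter> {x. (x, \<phi> g x) \<in> K}"
      using True by auto
    then show ?thesis
      using True first_sets[OF True] rel_vimage_sets[OF K(2) measurable_ident measurable_act[OF True]]
      by (simp add: id_def)
  qed simp
  then show ?thesis
    unfolding emeasure_section[OF K(1)] by measurable
qed

text \<open>\<open>measure_of\<close> keeps the prescribed values only if they are countably
  additive; this comes from exchanging sum and integral, legitimate by
  \<open>measurable_section\<close>.\<close>

lemma emeasure_rel:
  assumes "K \<in> sets MR" shows "emeasure MR K = section_integral \<mu> K"
proof (rule emeasure_measure_of[OF rel_measure_def])
  show "sets (restrict_space (\<mu> \<Otimes>\<^sub>M \<mu>) R) \<subseteq> Pow R"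
    using sets.space_closed[of "restrict_space (\<mu> \<Otimes>\<^sub>M \<mu>) R"]
    by (auto simp: space_restrict_space)
  show "positive (sets MR) (section_integral \<mu>)"
    by (simp add: positive_def section_integral_def)
  show "countably_additive (sets MR) (section_integral \<mu>)"
  proof (rule countably_additiveI)
    fix A :: "nat \<Rightarrow> ('a \<times> 'a) set"
    assume A: "range A \<subseteq> sets MR" "disjoint_family A"
    have UN: "(\<Sum>i. emeasure (count_space UNIV) (A i `` {x})) =
        emeasure (count_space UNIV) ((\<Union>i. A i) `` {x})" for x
    proof -
      have "disjoint_family (\<lambda>i. A i `` {x})"
        using A(2) by (auto simp: disjoint_family_on_def)
      then show ?thesis
        by (subst suminf_emeasure) (auto intro!: arg_cong[where f = "emeasure _"])
    qed
    have "(\<Sum>i. section_integral \<mu> (A i)) =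
        (\<integral>\<^sup>+ x. (\<Sum>i. emeasure (count_space UNIV) (A i `` {x})) \<partial>\<mu>)"
      unfolding section_integral_def
      using A(1) by (intro nn_integral_suminf[symmetric] measurable_section) auto
    then show "(\<Sum>i. section_integral \<mu> (A i)) = section_integral \<mu> (\<Union>i. A i)"
      by (simp add: section_integral_def UN)
  qed
qed fact

text \<open>Counting measure vanishes only on the empty set. All questions about null subsets of
  \<open>R\<close> thereby become almost-everywhere statements on the base.\<close>

lemma null_sets_rel_iff:
  assumes "K \<in> sets MR" shows "K \<in> null_sets MR \<longleftrightarrow> (AE x in \<mu>. K `` {x} = {})"
proof -
  have "K \<in> null_sets MR \<longleftrightarrow> (AE x in \<mu>. emeasure (count_space UNIV) (K `` {x}) = 0)"
    using assms nn_integral_0_iff_AE[OF measurable_section[OF assms]]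
    by (simp add: null_sets_def emeasure_rel section_integral_def)
  also have "\<dots> \<longleftrightarrow> (AE x in \<mu>. K `` {x} = {})"
    by (simp add: emeasure_count_space_eq_0)
  finally show ?thesis .
qed

lemma Id_sets_rel: "Id \<in> sets MR"
  using Id_sets by (auto simp: sets_rel_measure R_refl)

section \<open>Maps acting piecewise as group elements\<close>

text \<open>Each piece keeps its measure under its group element. This serves both everywhere
  defined bijections and the partial greedy map.\<close>

lemma emeasure_UN_translate:
  assumes a: "\<And>n. a n \<in> carrier G" and P: "\<And>n. P n \<in> sets \<mu>"
    and "disjoint_family (P :: nat \<Rightarrow> _)" "disjoint_family (\<lambda>n. \<phi> (a n) ` P n)"
  shows "emeasure \<mu> (\<Union>n. P n) = emeasure \<mu> (\<Union>n. \<phi> (a n) ` P n)"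
proof -
  have "emeasure \<mu> (\<Union>n. P n) = (\<Sum>n. emeasure \<mu> (P n))"
    using P assms(3) by (intro suminf_emeasure[symmetric]) auto
  also have "\<dots> = (\<Sum>n. emeasure \<mu> (\<phi> (a n) ` P n))"
    by (simp add: emeasure_act_image[OF a P])
  also have "\<dots> = emeasure \<mu> (\<Union>n. \<phi> (a n) ` P n)"
    using act_image_sets[OF a P] assms(4) by (intro suminf_emeasure) auto
  finally show ?thesis .
qed

text \<open>Cut along \<open>first\<close>, \<open>U\<close> acts on each piece as one group
  element, and injectivity keeps the image pieces disjoint.\<close>

lemma distr_bij_in_R:
  assumes U: "U \<in> measurable \<mu> \<mu>" "bij U" and UR: "\<And>x. (x, U x) \<in> R"
  shows "distr \<mu> \<mu> U = \<mu>"
proof (rule measure_eqI)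
  fix B assume "B \<in> sets (distr \<mu> \<mu> U)"
  then have B: "B \<in> sets \<mu>" by simp
  \<comment> \<open>Indices outside the carrier get the identity as a dummy value; their pieces
    \<open>P g\<close> are empty.\<close>
  define a where "a g = (if g \<in> carrier G then g else \<one>)" for g
  define P where "P g = {x. g \<in> carrier G \<and> x \<in> first g \<and> U x = \<phi> g x \<and> U x \<in> B}" for g
  have img: "\<phi> (a g) ` P g = U ` P g" for g
    by (auto simp: P_def a_def image_iff)
  have UN: "(\<Union>g. P g) = U -` B"
    by (auto simp: P_def intro: first_exists[OF UR])
  have disj: "disjoint_family P"
    using first_unique by (auto simp: disjoint_family_on_def P_def)
  have "P g \<in> sets \<mu>" for g
  proof (cases "g \<in> carrier G")
    case True
    then have "P g = first g \<inter> {x. U x = \<phi> g x} \<inter> U -` B"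
      by (auto simp: P_def)
    with True U B show ?thesis
      by (auto intro!: sets.Int measurable_eq_set measurable_vimage measurable_act)
  qed (simp add: P_def)
  moreover have "disjoint_family (\<lambda>g. \<phi> (a g) ` P g)"
    unfolding img disjoint_family_on_def image_Int[OF bij_is_inj[OF U(2)], symmetric]
    using disj by (simp add: disjoint_family_on_def)
  ultimately have "emeasure \<mu> (\<Union>g. P g) = emeasure \<mu> (\<Union>g. \<phi> (a g) ` P g)"
    using disj by (intro emeasure_UN_translate) (auto simp: a_def)
  also have "(\<Union>g. \<phi> (a g) ` P g) = U ` (\<Union>g. P g)"
    unfolding img by blast
  also have "\<dots> = B"
    unfolding UN by (rule surj_image_vimage_eq[OF bij_is_surj[OF U(2)]])
  finally show "emeasure (distr \<mu> \<mu> U) B = emeasure \<mu> B"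
    using B U(1) by (simp add: UN emeasure_distr)
qed simp

end

section \<open>The greedy construction\<close>

text \<open>The partial map acting as \<open>f n\<close> on the \<open>n\<close>-th piece is injective and sends \<open>x\<close> and \<open>h x\<close>, for
  \<open>h \<in> F\<close>, to \<open>S\<close>-inequivalent points. Requiring \<open>h x = x \<or> h x \<notin> V n\<close> prevents conflicts inside
  a single piece.\<close>

fun greedy_piece ::
  "(nat \<Rightarrow> 'a \<Rightarrow> 'a) \<Rightarrow> (nat \<Rightarrow> 'a set) \<Rightarrow> ('a \<Rightarrow> 'a) set \<Rightarrow> ('a \<times> 'a) set \<Rightarrow> nat \<Rightarrow> 'a set" where
  "greedy_piece f V F S n = {x \<in> V n. (\<forall>h\<in>F. h x = x \<or> h x \<notin> V n) \<and>
    (\<forall>k<n. x \<notin> greedy_piece f V F S k \<and> f n x \<notin> f k ` greedy_piece f V F S k \<and>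
      (\<forall>h\<in>F. h x \<in> greedy_piece f V F S k \<longrightarrow> (f n x, f k (h x)) \<notin> S))}"

declare greedy_piece.simps [simp del]

lemma disjoint_family_natI:
  fixes A :: "nat \<Rightarrow> 'a set"
  assumes "\<And>k n x. k < n \<Longrightarrow> x \<in> A n \<Longrightarrow> x \<notin> A k"
  shows "disjoint_family A"
  unfolding disjoint_family_on_def by (metis assms disjoint_iff linorder_neqE_nat)

lemma greedy_piece_disjoint: "disjoint_family (greedy_piece f V F S)"
proof (rule disjoint_family_natI)
  fix k n x assume "k < n" "x \<in> greedy_piece f V F S n"
  from this(2,1) show "x \<notin> greedy_piece f V F S k"
    by (subst (asm) greedy_piece.simps) simp
qed

lemma greedy_piece_image_disjoint: "disjoint_family (\<lambda>n. f n ` greedy_piece f V F S n)"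
proof (rule disjoint_family_natI)
  fix k n y assume k: "k < n" and "y \<in> f n ` greedy_piece f V F S n"
  then obtain x where y: "y = f n x" and "x \<in> greedy_piece f V F S n" by blast
  from this(2) k show "y \<notin> f k ` greedy_piece f V F S k"
    unfolding y by (subst (asm) greedy_piece.simps) simp
qed

text \<open>A piece is compared only with earlier ones. If \<open>h x\<close> lies in a later piece,
  the roles are exchanged through \<open>h'\<close> and the symmetry of \<open>S\<close>; the same
  piece is ruled out by the condition on \<open>V n\<close>.\<close>

lemma greedy_piece_separated:
  assumes "sym S" and h: "h \<in> F" "h' \<in> F" "h' (h x) = x"
    and x: "x \<in> greedy_piece f V F S n" "h x \<in> greedy_piece f V F S k" "h x \<noteq> x"
  shows "(f n x, f k (h x)) \<notin> S"
proof (cases n k rule: linorder_cases)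
  case less
  then have "(f k (h x), f n x) \<notin> S"
    using x(2) x(1) h(2,3) by (subst (asm) greedy_piece.simps) force
  with \<open>sym S\<close> show ?thesis by (meson symD)
next
  case equal
  with x h(1) have False
    by (subst (asm) greedy_piece.simps, subst (asm) (2) greedy_piece.simps) auto
  then show ?thesis ..
next
  case greater
  with x(1,2) h(1) show ?thesis
    by (subst (asm) greedy_piece.simps) auto
qed

text \<open>The hypotheses satisfy every other clause of the definition, so stage \<open>n\<close>
  can have rejected \<open>x\<close> only because of the clause about \<open>S\<close>.\<close>

lemma greedy_piece_maximal:
  assumes "x \<notin> (\<Union>k. greedy_piece f V F S k)" "f n x \<notin> (\<Union>k. f k ` greedy_piece f V F S k)"
    and "x \<in> V n" "\<And>h. h \<in> F \<Longrightarrow> h x = x \<or> h x \<notin> V n"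
  obtains h k where "h \<in> F" "h x \<in> greedy_piece f V F S k" "(f n x, f k (h x)) \<in> S"
proof -
  have "x \<notin> greedy_piece f V F S n" using assms(1) by blast
  then have "\<exists>h\<in>F. \<exists>k. h x \<in> greedy_piece f V F S k \<and> (f n x, f k (h x)) \<in> S"
    by (subst (asm) greedy_piece.simps) (use assms in blast)
  then show thesis using that by blast
qed

context pmp_action
begin

section \<open>Saturations, and the greedy map for an orbit relation\<close>

lemma R_Image_eq_UN: "R `` A = (\<Union>g\<in>carrier G. \<phi> g ` A)"
  by (auto simp: Image_def mem_R_iff)

lemma saturation_sets: "A \<in> sets \<mu> \<Longrightarrow> R `` A \<in> sets \<mu>"
  unfolding R_Image_eq_UN by (intro sets.countable_UN') (auto intro: act_image_sets)

lemma saturation_null: "A \<in> null_sets \<mu> \<Longrightarrow> R `` A \<in> null_sets \<mu>"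
  unfolding R_Image_eq_UN
  by (intro null_sets_UN') (auto simp: null_sets_def act_image_sets emeasure_act_image)

lemma subset_saturation: "A \<subseteq> R `` A"
  using R_refl by auto

lemma saturation_invariant: "(x, y) \<in> R \<Longrightarrow> x \<in> R `` A \<longleftrightarrow> y \<in> R `` A"
  by (auto intro: R_trans R_sym)

lemma greedy_piece_sets:
  assumes a: "\<And>n. a n \<in> carrier G" and V: "\<And>n. V n \<in> sets \<mu>"
    and F: "finite F" "F \<subseteq> carrier G" and S: "S \<in> sets (\<mu> \<Otimes>\<^sub>M \<mu>)"
  shows "greedy_piece (\<lambda>n. \<phi> (a n)) V (\<phi> ` F) S n \<in> sets \<mu>"
proof (induction n rule: less_induct)
  case (less n)
  let ?P = "greedy_piece (\<lambda>n. \<phi> (a n)) V (\<phi> ` F) S"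
  \<comment> \<open>The quantifiers become finite unions over \<open>F\<close> and over earlier
    stages; images under group elements are Borel because the inverses act too.\<close>
  have eq: "?P n = V n - (\<Union>h\<in>F. \<phi> h -` V n - {x. \<phi> h x = x}) -
    (\<Union>k<n. ?P k \<union> \<phi> (a n) -` \<phi> (a k) ` ?P k \<union>
      (\<Union>h\<in>F. \<phi> h -` ?P k \<inter> {x. (\<phi> (a n) x, \<phi> (a k) (\<phi> h x)) \<in> S}))"
    by (subst greedy_piece.simps) auto
  have h: "h \<in> carrier G" if "h \<in> F" for h using F that by auto
  have 1: "\<phi> h -` V n - {x. \<phi> h x = x} \<in> sets \<mu>" if "h \<in> F" for h
    using measurable_eq_set[OF measurable_act[OF h[OF that]] measurable_ident]
      measurable_vimage[OF measurable_act[OF h[OF that]] V]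
    by (auto simp: id_def)
  have 2: "\<phi> h -` ?P k \<inter> {x. (\<phi> (a n) x, \<phi> (a k) (\<phi> h x)) \<in> S} \<in> sets \<mu>" if "h \<in> F" "k < n" for h k
    using measurable_compose[OF measurable_act[OF h[OF that(1)]] measurable_act[OF a[of k]]]
    by (intro sets.Int measurable_vimage rel_vimage_sets measurable_act S a h less that)
  show ?case
    unfolding eq
    by (intro sets.Diff sets.finite_UN sets.Un measurable_vimage act_image_sets measurable_act 1 2 V a F less)
      (use F in auto)
qed

text \<open>The greedy map is run over all group elements and basic open sets, shown to have null
  defects, and completed by the identity on an invariant null set.\<close>

lemma exists_separating_bijection:
  assumes eii: "everywhere_infinite_index \<mu> R S" and sub: "Borel_subrel \<mu> R S"
    and F: "finite F" "F \<subseteq> carrier G" "\<And>h. h \<in> F \<Longrightarrow> inv h \<in> F"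
  obtains U where "bij U" "U \<in> measurable \<mu> \<mu>" "inv_into UNIV U \<in> measurable \<mu> \<mu>"
    "\<And>x. (x, U x) \<in> R"
    "AE x in \<mu>. \<forall>h\<in>F. \<phi> h x \<noteq> x \<longrightarrow> (U x, U (\<phi> h x)) \<notin> S"
proof -
  have S: "equiv UNIV S" "S \<in> sets (\<mu> \<Otimes>\<^sub>M \<mu>)" "S \<subseteq> R"
    using sub by (auto simp: Borel_subrel_def)
  obtain B :: "'a set set" where B: "countable B" "topological_basis B"
    using ex_countable_basis by blast
  \<comment> \<open>Every group element is to be tried on every basic open set: stage
    \<open>n\<close> applies \<open>\<phi> (a n)\<close> on \<open>V n\<close>.\<close>
  define e where "e = from_nat_into (carrier G \<times> B)"
  define a where "a n = fst (e n)" for n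
  define V where "V n = snd (e n)" for n
  have "B \<noteq> {}"
    using topological_basisE[OF B(2) open_UNIV UNIV_I] by blast
  then have ne: "carrier G \<times> B \<noteq> {}" by auto
  have e: "e n \<in> carrier G \<times> B" for n
    unfolding e_def by (rule from_nat_into[OF ne])
  have e_surj: "\<exists>n. a n = g \<and> V n = v" if "g \<in> carrier G" "v \<in> B" for g v
  proof -
    have "(g, v) \<in> range e"
      unfolding e_def using that B(1) by (subst range_from_nat_into[OF ne]) auto
    then show ?thesis unfolding a_def V_def by (metis fst_conv rangeE snd_conv)
  qed
  have a: "a n \<in> carrier G" for n using e[of n] by (auto simp: a_def)
  have V: "V n \<in> sets \<mu>" for n
    using e[of n] topological_basis_open[OF B(2)] by (auto simp: V_def sets_eq_borel)
  define f where "f n = \<phi> (a n)" for n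
  define P where "P = greedy_piece f V (\<phi> ` F) S"
  have P: "P n \<in> sets \<mu>" for n
    unfolding P_def f_def by (intro greedy_piece_sets a V F S)
  have P_disj: "disjoint_family P" and fP_disj: "disjoint_family (\<lambda>n. f n ` P n)"
    unfolding P_def by (rule greedy_piece_disjoint greedy_piece_image_disjoint)+
  have f_R: "(x, f n x) \<in> R" for x n
    unfolding f_def by (rule act_mem_R[OF a])
  have f_image: "A \<in> sets \<mu> \<Longrightarrow> f n ` A \<in> sets \<mu>" for A n
    unfolding f_def by (intro act_image_sets a)
  have f_inj: "f n x = f n y \<Longrightarrow> x = y" for n x y
    using a by (simp add: f_def)
  define D where "D = (\<Union>n. P n)"
  define E where "E = (\<Union>n. f n ` P n)"
  have D: "D \<in> sets \<mu>" and E: "E \<in> sets \<mu>"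
    unfolding D_def E_def using P f_image by auto
  \<comment> \<open>Disjointness of the pieces makes \<open>LEAST\<close> pick the only candidate;
    off \<open>D\<close> the value is arbitrary.\<close>
  define U0 where "U0 x = f (LEAST k. x \<in> P k) x" for x
  have U0: "U0 x = f k x" if "x \<in> P k" for x k
  proof -
    have "x \<in> P (LEAST k. x \<in> P k)" by (rule LeastI[of _ k]) fact
    with that P_disj have "(LEAST k. x \<in> P k) = k"
      by (auto simp: disjoint_family_on_def)
    then show ?thesis by (simp add: U0_def)
  qed

  \<comment> \<open>\<open>W\<close> is the union of the classes on which the greedy map is not
    total, and \<open>A\<close> is what its range misses there. Finite index on \<open>A\<close>
    will force \<open>A\<close> to be null.\<close>
  define W where "W = R `` (- D)"
  define A where "A = W - E"
  have W: "W \<in> sets \<mu>"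
    unfolding W_def using D sets.compl_sets[OF D] by (intro saturation_sets) (simp add: Compl_eq_Diff_UNIV)
  have A: "A \<in> sets \<mu>" unfolding A_def using W E by auto
  have fin: "finite ((Restr R A `` {y}) // Restr S A)" if "y \<in> A" for y
  proof -
    from that obtain x where x: "x \<notin> D" "(x, y) \<in> R"
      by (auto simp: A_def W_def)
    \<comment> \<open>Removing the finitely many points \<open>\<phi> h x\<close> other than
      \<open>x\<close> leaves an open neighbourhood; a basic \<open>v\<close> inside it meets the
      condition on \<open>V n\<close>.\<close>
    define O' where "O' = - ((\<lambda>h. \<phi> h x) ` F - {x})"
    have "open O'" "x \<in> O'"
      unfolding O'_def using F(1) by (auto intro!: open_Compl finite_imp_closed simp del: Compl_Diff_eq)
    then obtain v where v: "v \<in> B" "x \<in> v" "v \<subseteq> O'"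
      using topological_basisE[OF B(2)] by metis
    \<comment> \<open>Some stage tries to send \<open>x\<close> to \<open>z\<close>; as
      \<open>x\<close> stays outside \<open>D\<close> and \<open>z\<close> outside \<open>E\<close>,
      only an \<open>S\<close>-clash with some \<open>U0 (\<phi> h x)\<close> can have prevented
      it.\<close>
    have close: "\<exists>h\<in>F. (z, U0 (\<phi> h x)) \<in> S" if z: "(x, z) \<in> R" "z \<notin> E" for z
    proof -
      from z(1) obtain g where g: "g \<in> carrier G" "z = \<phi> g x" by (auto simp: mem_R_iff)
      from e_surj[OF g(1) v(1)] obtain n where n: "a n = g" "V n = v" by blast
      have "x \<notin> (\<Union>k. greedy_piece f V (\<phi> ` F) S k)" "f n x \<notin> (\<Union>k. f k ` greedy_piece f V (\<phi> ` F) S k)"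
        using x(1) z(2) g n by (auto simp: D_def E_def P_def f_def)
      moreover have "x \<in> V n" "\<And>h. h \<in> \<phi> ` F \<Longrightarrow> h x = x \<or> h x \<notin> V n"
        using v by (auto simp: n O'_def)
      ultimately obtain h k where "h \<in> \<phi> ` F" "h x \<in> P k" "(f n x, f k (h x)) \<in> S"
        unfolding P_def by (rule greedy_piece_maximal)
      moreover have "f n x = z" using g n by (simp add: f_def)
      ultimately show ?thesis using U0 by force
    qed
    have "(Restr R A `` {y}) // Restr S A \<subseteq> (\<lambda>h. S `` {U0 (\<phi> h x)} \<inter> A) ` F"
    proof
      fix c assume "c \<in> (Restr R A `` {y}) // Restr S A"
      then obtain z where z: "(y, z) \<in> R" "z \<in> A" and c: "c = Restr S A `` {z}"
        by (auto simp: quotient_def)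
      from R_trans[OF x(2) z(1)] z(2) obtain h where h: "h \<in> F" "(z, U0 (\<phi> h x)) \<in> S"
        using close by (auto simp: A_def)
      have "S `` {z} = S `` {U0 (\<phi> h x)}"
        by (rule equiv_class_eq[OF S(1) h(2)])
      then have "c = S `` {U0 (\<phi> h x)} \<inter> A"
        using z(2) c by auto
      with h(1) show "c \<in> (\<lambda>h. S `` {U0 (\<phi> h x)} \<inter> A) ` F" by blast
    qed
    then show ?thesis using F(1) finite_surj by blast
  qed
  have A0: "emeasure \<mu> A = 0"
  proof (rule ccontr)
    assume "emeasure \<mu> A \<noteq> 0"
    with eii A have "AE x in \<mu>. x \<in> A \<longrightarrow> infinite ((Restr R A `` {x}) // Restr S A)"
      by (simp add: everywhere_infinite_index_def zero_less_iff_neq_zero)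
    with fin have "AE x in \<mu>. x \<notin> A"
      by (auto elim!: eventually_mono)
    with A have "emeasure \<mu> A = 0"
      by (simp add: AE_iff_null_sets null_setsD1)
    with \<open>emeasure \<mu> A \<noteq> 0\<close> show False ..
  qed
  \<comment> \<open>Each \<open>f n\<close> preserves an invariant \<open>C\<close>, so the
    piecewise translation from \<open>D\<close> to \<open>E\<close> restricts to \<open>C\<close>.
    It is applied to \<open>W\<close> and to the whole space.\<close>
  have translate: "emeasure \<mu> (D \<inter> C) = emeasure \<mu> (E \<inter> C)"
    if C: "C \<in> sets \<mu>" and inv: "\<And>x y. (x, y) \<in> R \<Longrightarrow> x \<in> C \<longleftrightarrow> y \<in> C" for C
  proof -
    have im: "f n ` (P n \<inter> C) = f n ` P n \<inter> C" for n
      using inv[OF f_R] by auto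
    have "emeasure \<mu> (\<Union>n. P n \<inter> C) = emeasure \<mu> (\<Union>n. \<phi> (a n) ` (P n \<inter> C))"
    proof (rule emeasure_UN_translate)
      show "disjoint_family (\<lambda>n. P n \<inter> C)"
        using P_disj by (auto simp: disjoint_family_on_def)
      show "disjoint_family (\<lambda>n. \<phi> (a n) ` (P n \<inter> C))"
        using fP_disj unfolding f_def[symmetric] im disjoint_family_on_def by blast
    qed (use a P C in auto)
    then show ?thesis
      unfolding f_def[symmetric] im by (simp add: D_def E_def)
  qed
  have "prob (W - D) = prob W - prob (D \<inter> W)"
    using finite_measure_Diff'[OF W D] by (simp add: Int_commute)
  also have "prob (D \<inter> W) = prob (E \<inter> W)"
    using translate[OF W] saturation_invariant by (simp add: W_def measure_def)
  also have "prob W - prob (E \<inter> W) = prob (W - E)"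
    using finite_measure_Diff'[OF W E] by (simp add: Int_commute)
  finally have "emeasure \<mu> (W - D) = 0"
    using A0 by (simp add: A_def emeasure_eq_measure)
  moreover have "W - D = - D" using subset_saturation[of "- D"] by (auto simp: W_def)
  ultimately have D0: "- D \<in> null_sets \<mu>"
    using sets.compl_sets[OF D] by (simp add: null_sets_def Compl_eq_Diff_UNIV)
  have E0: "- E \<in> null_sets \<mu>"
  proof -
    have "emeasure \<mu> (UNIV - E) = emeasure \<mu> (UNIV - D)"
      using translate[of UNIV] sets.top[of \<mu>] D E
      by (simp add: emeasure_Diff)
    then show ?thesis
      using D0 sets.compl_sets[OF E] by (simp add: null_sets_def Compl_eq_Diff_UNIV)
  qed

  \<comment> \<open>Saturating makes the exceptional null set invariant, so \<open>U0\<close>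
    permutes its complement and the identity can be used on \<open>N\<close>.\<close>
  define N where "N = R `` (- D \<union> - E)"
  have N0: "N \<in> null_sets \<mu>"
    unfolding N_def by (intro saturation_null null_sets.Un D0 E0)
  then have N: "N \<in> sets \<mu>" by auto
  have N_inv: "(x, y) \<in> R \<Longrightarrow> x \<in> N \<longleftrightarrow> y \<in> N" for x y
    unfolding N_def by (rule saturation_invariant)
  have notN: "x \<in> D" "x \<in> E" if "x \<notin> N" for x
    using that subset_saturation[of "- D \<union> - E"] by (auto simp: N_def)
  define U where "U x = (if x \<in> N then x else U0 x)" for x
  have U: "U x = f k x" if "x \<notin> N" "x \<in> P k" for x k
    using that U0 by (simp add: U_def)
  have UR: "(x, U x) \<in> R" for x
    using notN[of x] f_R U[of x] R_refl by (cases "x \<in> N") (auto simp: D_def U_def)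
  have "bij U"
  proof (rule bijI)
    show "inj U"
    proof (rule injI)
      fix x y assume eq: "U x = U y"
      then have N_eq: "x \<in> N \<longleftrightarrow> y \<in> N"
        using N_inv[OF UR[of x]] N_inv[OF UR[of y]] by simp
      show "x = y"
      proof (cases "x \<in> N")
        case True
        then show ?thesis using eq N_eq by (simp add: U_def)
      next
        case False
        with N_eq notN have "x \<in> D" "y \<in> D" by auto
        then obtain n k where nk: "x \<in> P n" "y \<in> P k" by (auto simp: D_def)
        with False N_eq eq have f: "f n x = f k y" using U by auto
        with nk have "f n x \<in> f n ` P n" "f n x \<in> f k ` P k" by blast+
        with fP_disj have "n = k" by (auto simp: disjoint_family_on_def)
        with f show ?thesis using f_inj by blast
      qed
    qed
    show "surj U"
      unfolding surj_def
    proof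
      fix y
      show "\<exists>x. y = U x"
      proof (cases "y \<in> N")
        case True
        then show ?thesis by (auto simp: U_def)
      next
        case False
        from notN(2)[OF this] obtain k x where x: "x \<in> P k" "y = f k x" by (auto simp: E_def)
        with False N_inv[OF f_R[of x k]] have "x \<notin> N" by simp
        from U[OF this x(1)] x(2) show ?thesis by metis
      qed
    qed
  qed
  have "U -` C = (N \<inter> C) \<union> (\<Union>k. (P k - N) \<inter> f k -` C)" for C
  proof (rule Set.set_eqI)
    fix x
    show "x \<in> U -` C \<longleftrightarrow> x \<in> (N \<inter> C) \<union> (\<Union>k. (P k - N) \<inter> f k -` C)"
    proof (cases "x \<in> N")
      case True
      then show ?thesis by (simp add: U_def)
    next
      case False
      from notN(1)[OF this] obtain k where "x \<in> P k" by (auto simp: D_def)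
      then have "U x \<in> C \<longleftrightarrow> (\<exists>j. x \<in> P j \<and> f j x \<in> C)"
        using U[OF False] by metis
      with False show ?thesis by auto
    qed
  qed
  then have U_meas: "U \<in> measurable \<mu> \<mu>"
    using N P measurable_vimage[OF measurable_act[OF a]] by (intro measurableI) (auto simp: f_def)
  \<comment> \<open>Measurability of the inverse of a bijection amounts to measurability of images,
    here countable unions of translated Borel sets.\<close>
  have im: "U ` C = (N \<inter> C) \<union> (\<Union>k. f k ` (P k \<inter> C - N))" for C
  proof (intro equalityI subsetI)
    fix y assume "y \<in> U ` C"
    then obtain x where x: "x \<in> C" "y = U x" by auto
    show "y \<in> (N \<inter> C) \<union> (\<Union>k. f k ` (P k \<inter> C - N))"
    proof (cases "x \<in> N")
      case False
      from notN(1)[OF this] obtain k where "x \<in> P k" by (auto simp: D_def)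
      with x False show ?thesis using U by auto
    qed (use x in \<open>auto simp: U_def\<close>)
  next
    fix y assume "y \<in> (N \<inter> C) \<union> (\<Union>k. f k ` (P k \<inter> C - N))"
    then show "y \<in> U ` C"
    proof
      assume "y \<in> N \<inter> C"
      then show ?thesis by (auto simp: U_def image_iff)
    qed (use U in \<open>force simp: image_iff\<close>)
  qed
  have "inv_into UNIV U -` C \<in> sets \<mu>" if "C \<in> sets \<mu>" for C
  proof -
    have "inv_into UNIV U -` C = U ` C"
      using \<open>bij U\<close> by (simp add: bij_vimage_eq_inv_image inv_inv_eq bij_imp_bij_inv)
    then show ?thesis
      unfolding im using N P that f_image by auto
  qed
  then have "inv_into UNIV U \<in> measurable \<mu> \<mu>"
    by (intro measurableI) auto
  moreover have "AE x in \<mu>. \<forall>h\<in>F. \<phi> h x \<noteq> x \<longrightarrow> (U x, U (\<phi> h x)) \<notin> S"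
    using AE_not_in[OF N0]
  proof eventually_elim
    case (elim x)
    show ?case
    proof (intro ballI impI)
      fix h assume h: "h \<in> F" "\<phi> h x \<noteq> x"
      then have hG: "h \<in> carrier G" using F by auto
      have hx: "\<phi> h x \<notin> N" using elim N_inv[OF act_mem_R[OF hG]] by blast
      from notN(1)[OF elim] notN(1)[OF hx] obtain n k where nk: "x \<in> P n" "\<phi> h x \<in> P k"
        by (auto simp: D_def)
      have "(f n x, f k (\<phi> h x)) \<notin> S"
        by (rule greedy_piece_separated[of _ _ "\<phi> ` F" "\<phi> (inv h)"])
          (use nk h hG F S(1) in \<open>auto simp: P_def equiv_def\<close>)
      then show "(U x, U (\<phi> h x)) \<notin> S"
        using U[OF elim nk(1)] U[OF hx nk(2)] by simp
    qed
  qed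
  ultimately show thesis
    using that \<open>bij U\<close> U_meas UR by blast
qed

end

section \<open>The closure of an orbit in the space of subrelations\<close>

lemma mem_map_prod_image_iff:
  assumes "bij T"
  shows "(x, y) \<in> map_prod T T ` K \<longleftrightarrow> (inv_into UNIV T x, inv_into UNIV T y) \<in> K"
proof
  assume "(x, y) \<in> map_prod T T ` K"
  then show "(inv_into UNIV T x, inv_into UNIV T y) \<in> K"
    using bij_is_inj[OF assms] by (auto simp: inv_f_f)
next
  assume "(inv_into UNIV T x, inv_into UNIV T y) \<in> K"
  then have "map_prod T T (inv_into UNIV T x, inv_into UNIV T y) \<in> map_prod T T ` K"
    by (rule imageI)
  then show "(x, y) \<in> map_prod T T ` K"
    using surj_f_inv_f[OF bij_is_surj[OF assms]] by simp
qed

context pmp_action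
begin

lemma map_prod_image_sets:
  assumes T: "T \<in> Aut_space \<mu>" and K: "K \<in> sets (\<mu> \<Otimes>\<^sub>M \<mu>)"
  shows "map_prod T T ` K \<in> sets (\<mu> \<Otimes>\<^sub>M \<mu>)"
proof -
  have "map_prod T T ` K = map_prod (inv_into UNIV T) (inv_into UNIV T) -` K"
    using T by (intro Set.set_eqI) (simp add: Aut_space_def split_paired_all mem_map_prod_image_iff del: image_iff)
  then show ?thesis
    using T K map_prod_vimage_sets by (simp add: Aut_space_def)
qed

text \<open>Moving points inside their classes already makes \<open>T\<close> preserve
  \<open>R\<close> exactly and, by \<open>distr_bij_in_R\<close>, preserve the measure.\<close>

lemma in_full_groupI:
  assumes "bij T" "T \<in> measurable \<mu> \<mu>" "inv_into UNIV T \<in> measurable \<mu> \<mu>" "\<And>x. (x, T x) \<in> R"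
  shows "T \<in> full_group \<mu> R"
proof -
  have inv: "(inv_into UNIV T x, x) \<in> R" for x
    using assms(4)[of "inv_into UNIV T x"] surj_f_inv_f[OF bij_is_surj[OF assms(1)]] by simp
  have "(x, y) \<in> map_prod T T ` R \<longleftrightarrow> (x, y) \<in> R" for x y
    unfolding mem_map_prod_image_iff[OF assms(1)] using inv by (meson R_sym R_trans)
  then have "map_prod T T ` R = R"
    by auto
  then show ?thesis
    using assms distr_bij_in_R[of T]
    by (simp add: full_group_def Aut_rel_def Aut_space_def section_integral_def)
qed

lemma sets_rel_map_prod_image:
  assumes "T \<in> Aut_space \<mu>" "Borel_subrel \<mu> R S"
  shows "map_prod T T ` S \<inter> R \<in> sets MR"
  using assms map_prod_image_sets R_sets by (auto simp: Borel_subrel_def sets_rel_measure)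

lemma Borel_subrel_map_prod_image:
  assumes T: "T \<in> Aut_space \<mu>" and S: "Borel_subrel \<mu> R S"
  shows "Borel_subrel \<mu> R (map_prod T T ` S \<inter> R)"
proof -
  have "bij T" using T by (simp add: Aut_space_def)
  note iff = mem_map_prod_image_iff[OF this]
  have S': "equiv UNIV S" using S by (simp add: Borel_subrel_def)
  have "equiv UNIV (map_prod T T ` S \<inter> R)"
  proof (rule equivI)
    show "refl (map_prod T T ` S \<inter> R)"
      using S' R_refl by (auto simp: refl_on_def iff equiv_def simp del: image_iff)
    show "sym (map_prod T T ` S \<inter> R)"
      using S' R_sym unfolding sym_def Int_iff iff equiv_def by blast
    show "trans (map_prod T T ` S \<inter> R)"
      using S' R_trans unfolding trans_def Int_iff iff equiv_def by blast
  qed auto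
  then show ?thesis
    using sets_rel_map_prod_image[OF T S] by (auto simp: Borel_subrel_def sets_rel_measure)
qed

text \<open>The moved relation is reflexive, so its symmetric difference with the diagonal is its
  off-diagonal part. The orbit lies in \<open>Sub \<mu> R\<close>, so closure in the subspace is a
  condition on metric balls.\<close>

lemma mem_closure_rel_orbit_iff:
  assumes m: "finite_measure m" "equivalent_measures m MR"
    and \<Gamma>: "\<Gamma> \<subseteq> Aut_space \<mu>" and S: "Borel_subrel \<mu> R S"
  shows "mclass MR Id \<in> Sub_topology \<mu> R m closure_of rel_orbit \<mu> R \<Gamma> S \<longleftrightarrow>
    (\<forall>r>0. \<exists>T\<in>\<Gamma>. measure m (map_prod T T ` S \<inter> R - Id) < r)"
proof -
  interpret MS: Metric_space "MAlg MR" "MAlg_dist m"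
    by (rule Metric_space_MAlg[OF m])
  define K where "K T = map_prod T T ` S \<inter> R" for T
  have K: "K T \<in> sets MR" "Borel_subrel \<mu> R (K T)" if "T \<in> \<Gamma>" for T
    unfolding K_def using that \<Gamma> S sets_rel_map_prod_image Borel_subrel_map_prod_image by blast+
  have in_MAlg: "mclass MR A \<in> MAlg MR" if "A \<in> sets MR" for A
    using that by (auto simp: mclass_def MAlg_def quotientI)
  have "Borel_subrel \<mu> R Id"
    using Id_sets R_refl by (auto simp: Borel_subrel_def equiv_def refl_on_def sym_def trans_def)
  then have Id_Sub: "mclass MR Id \<in> Sub \<mu> R" by (auto simp: Sub_def)
  have orbit: "rel_orbit \<mu> R \<Gamma> S = (\<lambda>T. mclass MR (K T)) ` \<Gamma>"
    by (auto simp: rel_orbit_def K_def)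
  then have orbit_Sub: "rel_orbit \<mu> R \<Gamma> S \<subseteq> Sub \<mu> R"
    using K(2) by (auto simp: Sub_def)
  have dist: "MAlg_dist m (mclass MR Id) (mclass MR (K T)) = measure m (K T - Id)" if "T \<in> \<Gamma>" for T
  proof -
    have "sym_diff Id (K T) = K T - Id"
      using K(2)[OF that] by (auto simp: Borel_subrel_def equiv_def refl_on_def)
    then show ?thesis
      using MAlg_dist_mclass[OF m Id_sets_rel K(1)[OF that]] by simp
  qed
  have "mclass MR Id \<in> Sub_topology \<mu> R m closure_of rel_orbit \<mu> R \<Gamma> S \<longleftrightarrow>
      (\<forall>r>0. \<exists>T\<in>\<Gamma>. mclass MR (K T) \<in> MS.mball (mclass MR Id) r)"
    unfolding Sub_topology_def closure_of_subtopology MS.metric_closure_of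
    using orbit_Sub Id_Sub in_MAlg[OF Id_sets_rel] by (simp add: Int_absorb1 orbit)
  also have "\<dots> \<longleftrightarrow> (\<forall>r>0. \<exists>T\<in>\<Gamma>. measure m (K T - Id) < r)"
    using in_MAlg[OF Id_sets_rel] in_MAlg[OF K(1)] dist by (auto simp: MS.in_mball)
  finally show ?thesis unfolding K_def .
qed

text \<open>Graphs of finitely many group elements cover \<open>R\<close> up to
  \<open>m\<close>-measure less than \<open>r\<close>. Separating along them leaves, up to a null
  set, only the diagonal of the moved relation over these graphs.\<close>

lemma full_group_orbit_accumulates_at_Id:
  assumes eii: "everywhere_infinite_index \<mu> R S" and sub: "Borel_subrel \<mu> R S"
    and m: "finite_measure m" "equivalent_measures m MR" and "0 < r"
  shows "\<exists>T\<in>full_group \<mu> R. measure m (map_prod T T ` S \<inter> R - Id) < r"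
proof -
  interpret m: finite_measure m by fact
  have sets_m: "sets m = sets MR" and null_m: "null_sets MR \<subseteq> null_sets m"
    using m(2) by (auto simp: equivalent_measures_def absolutely_continuous_def)
  define F where "F n = carrier G \<inter> {..<n}" for n
  define Q where "Q n = R - (\<Union>g\<in>F n. {(x, y). y = \<phi> g x})" for n
  have "(\<Union>g\<in>F n. {(x, y). y = \<phi> g x}) \<in> sets (\<mu> \<Otimes>\<^sub>M \<mu>)" for n
    unfolding F_def using graph_sets[OF measurable_act] by (intro sets.finite_UN) auto
  then have Q: "Q n \<in> sets m" for n
    using R_sets by (auto simp: Q_def sets_m sets_rel_measure)
  have "(\<lambda>n. measure m (Q n)) \<longlonglongrightarrow> measure m (\<Inter>n. Q n)"
  proof (rule m.finite_Lim_measure_decseq)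
    show "decseq Q"
      by (intro decseq_SucI) (auto simp: Q_def F_def)
  qed (use Q in auto)
  moreover have "(\<Inter>n. Q n) = {}"
  proof -
    have "p \<notin> (\<Inter>n. Q n)" if "p \<in> R" for p
    proof -
      obtain x g where "p = (x, \<phi> g x)" "g \<in> carrier G"
        using \<open>p \<in> R\<close> by (cases p) (auto simp: mem_R_iff)
      \<comment> \<open>The bound in \<open>F\<close> is strict, so index \<open>g\<close> first
        appears at stage \<open>Suc g\<close>.\<close>
      then have "p \<notin> Q (Suc g)" by (auto simp: Q_def F_def)
      then show ?thesis by blast
    qed
    then show ?thesis by (auto simp: Q_def)
  qed
  ultimately have "(\<lambda>n. measure m (Q n)) \<longlonglongrightarrow> 0" by simp
  from order_tendstoD(2)[OF this \<open>0 < r\<close>] obtain n where n: "measure m (Q n) < r"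
    by (auto simp: eventually_sequentially)
  \<comment> \<open>Adjoining the inverses gives the symmetric set that the greedy construction
    requires.\<close>
  obtain U where U: "bij U" "U \<in> measurable \<mu> \<mu>" "inv_into UNIV U \<in> measurable \<mu> \<mu>"
    and UR: "\<And>x. (x, U x) \<in> R"
    and sep: "AE x in \<mu>. \<forall>h\<in>F n \<union> m_inv G ` F n. \<phi> h x \<noteq> x \<longrightarrow> (U x, U (\<phi> h x)) \<notin> S"
    by (rule exists_separating_bijection[OF eii sub, of "F n \<union> m_inv G ` F n"])
      (auto simp: F_def)
  \<comment> \<open>With the inverse of \<open>U\<close>, two points are related by the image of
    \<open>S\<close> iff \<open>U\<close> sends them to \<open>S\<close>-related points.\<close>
  define T where "T = inv_into UNIV U"
  have T: "bij T" "inv_into UNIV T = U"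
    using U(1) by (auto simp: T_def bij_imp_bij_inv inv_inv_eq)
  have "(x, T x) \<in> R" for x
    using UR[of "T x"] surj_f_inv_f[OF bij_is_surj[OF U(1)]] by (simp add: T_def R_sym)
  then have T_full: "T \<in> full_group \<mu> R"
    using U T by (intro in_full_groupI) (auto simp: T_def)
  then have "T \<in> Aut_space \<mu>" by (simp add: full_group_def Aut_rel_def)
  define K where "K = map_prod T T ` S \<inter> R - Id"
  have K: "K \<in> sets m"
    unfolding K_def sets_m using \<open>T \<in> Aut_space \<mu>\<close> sub Id_sets_rel
    by (intro sets.Diff sets_rel_map_prod_image)
  have "AE x in \<mu>. (K - Q n) `` {x} = {}"
    using sep
  proof eventually_elim
    case (elim x)
    have "(x, y) \<notin> K - Q n" for y
    proof
      assume xy: "(x, y) \<in> K - Q n"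
      then obtain g where "g \<in> F n" "y = \<phi> g x" "x \<noteq> y" "(U x, U y) \<in> S"
        by (auto simp: K_def Q_def mem_map_prod_image_iff[OF T(1)] T(2) simp del: image_iff)
      with elim show False by auto
    qed
    then show ?case by auto
  qed
  then have "K - Q n \<in> null_sets m"
    using null_m null_sets_rel_iff[of "K - Q n"] K Q by (auto simp: sets_m)
  then have "measure m (K - Q n) = 0"
    by (simp add: measure_eq_0_null_sets)
  moreover have "measure m K \<le> measure m (Q n) + measure m (K - Q n)"
    using m.finite_measure_mono[of K "Q n \<union> (K - Q n)"] measure_Un_le[of "Q n" m "K - Q n"] K Q
    by auto
  ultimately have "measure m K < r" using n by simp
  with T_full show ?thesis unfolding K_def by blast
qed

end

section \<open>Subrelations of finite index\<close>

lemma real_card_filter_eq_sum_indicator: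
  "finite F \<Longrightarrow> real (card {g \<in> F. x \<in> A g}) = (\<Sum>g\<in>F. indicator (A g) x)"
  by (simp add: indicator_def sum.If_cases Int_def)

context pmp_action
begin

lemma expectation_card_filter:
  assumes "finite F" "\<And>g. g \<in> F \<Longrightarrow> A g \<in> sets \<mu>"
  shows "integrable \<mu> (\<lambda>x. real (card {g \<in> F. x \<in> A g}))"
    and "expectation (\<lambda>x. real (card {g \<in> F. x \<in> A g})) = (\<Sum>g\<in>F. prob (A g))"
  unfolding real_card_filter_eq_sum_indicator[OF assms(1)]
  using assms by (auto intro!: Bochner_Integration.integrable_sum
      simp: emeasure_eq_measure Bochner_Integration.integral_sum)

lemma card_filter_sets:
  assumes "finite F" "\<And>g. g \<in> F \<Longrightarrow> A g \<in> sets \<mu>"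
  shows "{x. k \<le> card {g \<in> F. x \<in> A g}} \<in> sets \<mu>"
proof -
  have "(\<lambda>x. real (card {g \<in> F. x \<in> A g})) \<in> borel_measurable \<mu>"
    using expectation_card_filter(1)[OF assms] by auto
  then have "{x \<in> space \<mu>. real k \<le> real (card {g \<in> F. x \<in> A g})} \<in> sets \<mu>"
    by measurable
  then show ?thesis by simp
qed

text \<open>Mass transport: the expected number of points of \<open>C\<close> in \<open>F x\<close> equals the integral over
  \<open>C\<close> of the number of points of \<open>F\<inverse> y\<close>, which is large for most \<open>y\<close>. Since the former number is at
  most \<open>card F\<close>, it exceeds \<open>k\<close> with a probability bounded below independently of \<open>C\<close>.\<close>

lemma uniform_recurrence:
  assumes ap: "aperiodic \<mu> R" and "0 < c"
  obtains F \<delta> where "finite F" "F \<subseteq> carrier G" "0 < \<delta>"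
    "\<And>C. C \<in> sets \<mu> \<Longrightarrow> c \<le> prob C \<Longrightarrow>
      \<delta> \<le> prob {x. k < card {g \<in> F. x \<in> first g \<inter> \<phi> g -` C}}"
proof -
  define F where "F n = carrier G \<inter> {..<n}" for n
  have F: "finite (F n)" "F n \<subseteq> carrier G" for n by (auto simp: F_def)
  have fi: "\<phi> g ` first g \<in> sets \<mu>" if "g \<in> F n" for g n
    using that F(2)[of n] by (intro act_image_sets first_sets) auto
  \<comment> \<open>Chosen so that a set of measure \<open>c / 2\<close> counted \<open>L\<close>
    times has mass at least \<open>k + 1\<close>.\<close>
  obtain L :: nat where "(real k + 1) / (c / 2) \<le> real L"
    using real_arch_simple by blast
  with \<open>0 < c\<close> have L: "real k + 1 \<le> real L * (c / 2)"
    by (simp add: field_simps)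
  \<comment> \<open>\<open>B n\<close> holds the \<open>y\<close> reached through at least
    \<open>L\<close> indices in \<open>F n\<close>; infinite classes make these sets exhaust almost
    all of the space.\<close>
  define B where "B n = {y. L \<le> card {g \<in> F n. y \<in> \<phi> g ` first g}}" for n
  have B: "B n \<in> sets \<mu>" for n
    unfolding B_def by (intro card_filter_sets F fi)
  have "AE y in \<mu>. y \<in> (\<Union>n. B n)"
    using ap unfolding aperiodic_def
  proof eventually_elim
    case (elim y)
    define J where "J = {g \<in> carrier G. y \<in> \<phi> g ` first g}"
    have "R `` {y} \<subseteq> (\<lambda>g. \<phi> (inv g) y) ` J"
    proof
      fix x assume "x \<in> R `` {y}"
      then have "(x, y) \<in> R" by (simp add: R_sym)
      then obtain g where g: "g \<in> carrier G" "x \<in> first g" "y = \<phi> g x" by (rule first_exists)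
      then have "g \<in> J" "x = \<phi> (inv g) y" by (auto simp: J_def)
      then show "x \<in> (\<lambda>g. \<phi> (inv g) y) ` J" by blast
    qed
    with elim have "infinite J" using finite_surj by blast
    then obtain X where X: "X \<subseteq> J" "finite X" "card X = L"
      using infinite_arbitrarily_large by blast
    from X(2) obtain n where "X \<subseteq> {..<n}"
      using finite_nat_set_iff_bounded by (metis lessThan_iff subsetI)
    with X(1) have "X \<subseteq> {g \<in> F n. y \<in> \<phi> g ` first g}" by (auto simp: F_def J_def)
    with X(3) F(1) have "y \<in> B n"
      unfolding B_def by (auto intro!: card_mono simp del: image_iff)
    then show ?case by blast
  qed
  then have "prob (\<Union>n. B n) = 1"
    using B by (subst prob_eq_1) auto
  moreover have "(\<lambda>n. prob (B n)) \<longlonglongrightarrow> prob (\<Union>n. B n)"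
  proof (rule finite_Lim_measure_incseq)
    have "B n \<subseteq> B (Suc n)" for n
      unfolding B_def by (auto elim!: order_trans intro!: card_mono simp: F_def)
    then show "incseq B" by (rule incseq_SucI)
  qed (use B in auto)
  ultimately have "(\<lambda>n. prob (B n)) \<longlonglongrightarrow> 1" by simp
  \<comment> \<open>For this \<open>n\<close>, every \<open>C\<close> with
    \<open>c \<le> prob C\<close> meets \<open>B n\<close> in measure at least
    \<open>c / 2\<close>.\<close>
  from order_tendstoD(1)[OF this, of "1 - c / 2"] \<open>0 < c\<close>
  obtain n where n: "1 - c / 2 < prob (B n)"
    by (auto simp: eventually_sequentially)
  \<comment> \<open>The added 1 keeps the denominator positive even if \<open>F n\<close> is
    empty.\<close>
  define \<delta> where "\<delta> = 1 / (real (card (F n)) + 1)"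
  show thesis
  proof (rule that[OF F])
    show "0 < \<delta>" by (simp add: \<delta>_def)
    fix C assume C: "C \<in> sets \<mu>" "c \<le> prob C"
    define A where "A g = first g \<inter> \<phi> g -` C" for g
    define Z where "Z = {x. k < card {g \<in> F n. x \<in> A g}}"
    have A: "A g \<in> sets \<mu>" if "g \<in> F n" for g
      unfolding A_def using that F(2)[of n] C(1)
      by (intro sets.Int first_sets measurable_vimage measurable_act) auto
    have Z: "Z \<in> sets \<mu>"
      unfolding Z_def Suc_le_eq[symmetric] by (intro card_filter_sets F A)
    have image_A: "\<phi> g ` A g = \<phi> g ` first g \<inter> C" for g
      by (auto simp: A_def)
    \<comment> \<open>\<open>\<phi> g\<close> carries departure points onto arrival points in
      \<open>C\<close> without changing measure, so both counts have the same expectation.\<close>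
    have prob_A: "prob (A g) = prob (\<phi> g ` first g \<inter> C)" if "g \<in> F n" for g
      using emeasure_act_image[OF _ A[OF that], of g] that F(2)[of n]
      unfolding image_A measure_def by auto
    have "real L * (c / 2) \<le> real L * prob (B n \<inter> C)"
    proof -
      have [simp]: "UNIV - B n \<in> sets \<mu>"
        using sets.compl_sets[OF B, of n] by simp
      have "prob C \<le> prob ((B n \<inter> C) \<union> (UNIV - B n))"
        using B C by (intro finite_measure_mono) auto
      also have "\<dots> \<le> prob (B n \<inter> C) + prob (UNIV - B n)"
        using B C by (intro measure_Un_le) auto
      also have "prob (UNIV - B n) = 1 - prob (B n)"
        using prob_compl[OF B] by simp
      finally have "c / 2 \<le> prob (B n \<inter> C)" using n C(2) by linarith
      then show ?thesis by (intro mult_left_mono) auto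
    qed
    also have "\<dots> = expectation (\<lambda>y. real L * indicator (B n \<inter> C) y)"
      using B C by simp
    also have "\<dots> \<le> expectation (\<lambda>y. real (card {g \<in> F n. y \<in> \<phi> g ` first g \<inter> C}))"
    proof (rule integral_mono)
      show "integrable \<mu> (\<lambda>y. real L * indicator (B n \<inter> C) y)"
        using B C by (auto simp: emeasure_eq_measure)
      show "integrable \<mu> (\<lambda>y. real (card {g \<in> F n. y \<in> \<phi> g ` first g \<inter> C}))"
        using C by (intro expectation_card_filter F sets.Int fi)
      show "real L * indicator (B n \<inter> C) y \<le> real (card {g \<in> F n. y \<in> \<phi> g ` first g \<inter> C})" for y
        by (cases "y \<in> B n \<inter> C") (auto simp: B_def)
    qed
    also have "\<dots> = (\<Sum>g\<in>F n. prob (\<phi> g ` first g \<inter> C))"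
      using C by (intro expectation_card_filter F sets.Int fi)
    also have "\<dots> = (\<Sum>g\<in>F n. prob (A g))"
      using prob_A by simp
    also have "\<dots> = expectation (\<lambda>x. real (card {g \<in> F n. x \<in> A g}))"
      by (intro expectation_card_filter(2)[symmetric] F A)
    also have "\<dots> \<le> expectation (\<lambda>x. real k + real (card (F n)) * indicator Z x)"
    proof (rule integral_mono)
      show "integrable \<mu> (\<lambda>x. real (card {g \<in> F n. x \<in> A g}))"
        by (intro expectation_card_filter F A)
      show "integrable \<mu> (\<lambda>x. real k + real (card (F n)) * indicator Z x)"
        using Z by (auto simp: emeasure_eq_measure)
      have le: "card {g \<in> F n. x \<in> A g} \<le> card (F n)" for x
        by (intro card_mono F) auto
      show "real (card {g \<in> F n. x \<in> A g}) \<le> real k + real (card (F n)) * indicator Z x" for x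
        using le[of x] by (cases "x \<in> Z") (auto simp: Z_def)
    qed
    also have "\<dots> = real k + real (card (F n)) * prob Z"
      using Z by (simp add: emeasure_eq_measure prob_space[simplified])
    finally have "1 \<le> real (card (F n)) * prob Z" using L by linarith
    also have "\<dots> \<le> (real (card (F n)) + 1) * prob Z"
      by (intro mult_right_mono) auto
    finally show "\<delta> \<le> prob {x. k < card {g \<in> F n. x \<in> first g \<inter> \<phi> g -` C}}"
      by (simp add: \<delta>_def Z_def A_def field_simps)
  qed
qed

text \<open>Finite index on a non-null part of \<open>A\<close> splits into countably many bounds,
  so one \<open>k\<close> works on a set of positive measure. Finite sets of group elements stand in
  for finite sets of points and keep everything Borel.\<close>

lemma finite_index_set:
  assumes neii: "\<not> everywhere_infinite_index \<mu> R S" and sub: "Borel_subrel \<mu> R S"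
  obtains C k where "C \<in> sets \<mu>" "0 < prob C"
    "\<And>Y. Y \<subseteq> C \<Longrightarrow> k < card Y \<Longrightarrow> (\<And>y z. y \<in> Y \<Longrightarrow> z \<in> Y \<Longrightarrow> (y, z) \<in> R) \<Longrightarrow>
      \<exists>y\<in>Y. \<exists>z\<in>Y. y \<noteq> z \<and> (y, z) \<in> S"
proof -
  have S: "equiv UNIV S" "S \<in> sets (\<mu> \<Otimes>\<^sub>M \<mu>)"
    using sub by (auto simp: Borel_subrel_def)
  from neii obtain A where A: "A \<in> sets \<mu>"
    and nAE: "\<not> (AE x in \<mu>. x \<in> A \<longrightarrow> infinite ((Restr R A `` {x}) // Restr S A))"
    by (auto simp: everywhere_infinite_index_def)
  define T where "T k = {I. finite I \<and> I \<subseteq> carrier G \<and> card I = Suc k}" for k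
  define spread where "spread I = {x. (\<forall>g\<in>I. \<phi> g x \<in> A) \<and>
    (\<forall>g\<in>I. \<forall>h\<in>I. g \<noteq> h \<longrightarrow> (\<phi> g x, \<phi> h x) \<notin> S)}" for I
  \<comment> \<open>For \<open>x\<close> in \<open>B k\<close>, the class of \<open>x\<close>
    contains no \<open>k + 1\<close> pairwise \<open>S\<close>-inequivalent points of
    \<open>A\<close>; hence \<open>Suc k\<close> in \<open>T k\<close>.\<close>
  define B where "B k = A - (\<Union>I\<in>T k. spread I)" for k
  have spread: "spread I \<in> sets \<mu>" if "I \<in> T k" for I k
  proof -
    have I: "finite I" "\<And>g. g \<in> I \<Longrightarrow> g \<in> carrier G" using that by (auto simp: T_def)
    have "spread I = UNIV - ((\<Union>g\<in>I. \<phi> g -` (UNIV - A)) \<union>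
        (\<Union>g\<in>I. \<Union>h\<in>I - {g}. {x. (\<phi> g x, \<phi> h x) \<in> S}))"
      by (auto simp: spread_def)
    moreover have "\<dots> \<in> sets \<mu>"
      using sets.top[of \<mu>]
      by (intro sets.Diff sets.Un sets.finite_UN measurable_vimage rel_vimage_sets measurable_act I S A)
        (use I in auto)
    ultimately show ?thesis by simp
  qed
  have "countable (T k)" for k
    by (rule countable_subset[OF _ countable_Collect_finite]) (auto simp: T_def)
  then have B: "B k \<in> sets \<mu>" for k
    unfolding B_def using A spread by (intro sets.Diff sets.countable_UN') auto
  have fin: "\<exists>k. x \<in> B k" if x: "x \<in> A" and fin: "finite ((Restr R A `` {x}) // Restr S A)" for x
  proof -
    let ?Q = "(Restr R A `` {x}) // Restr S A"
    have "x \<notin> spread I" if I: "I \<in> T (card ?Q)" for I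
    proof
      assume sp: "x \<in> spread I"
      define q where "q g = Restr S A `` {\<phi> g x}" for g
      have "inj_on q I"
      proof (rule inj_onI)
        fix g h assume gh: "g \<in> I" "h \<in> I" "q g = q h"
        have "\<phi> h x \<in> q h"
          using sp gh S(1) by (auto simp: q_def spread_def equiv_def refl_on_def)
        with gh(3) have "(\<phi> g x, \<phi> h x) \<in> S" by (auto simp: q_def)
        with sp gh show "g = h" by (auto simp: spread_def)
      qed
      moreover have "q ` I \<subseteq> ?Q"
        using sp I x by (auto simp: q_def spread_def T_def act_mem_R intro!: quotientI)
      ultimately have "card I \<le> card ?Q"
        using fin by (metis card_image card_mono)
      with I show False by (simp add: T_def)
    qed
    with x show ?thesis by (auto simp: B_def)
  qed
  have "\<exists>k. 0 < prob (B k)"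
  proof (rule ccontr)
    assume "\<not> ?thesis"
    then have "prob (B k) = 0" for k
      by (metis measure_nonneg order_le_less)
    then have "(\<Union>k. B k) \<in> null_sets \<mu>"
      using B by (intro null_sets_UN) (auto simp: null_sets_def emeasure_eq_measure)
    from AE_not_in[OF this] have "AE x in \<mu>. x \<in> A \<longrightarrow> infinite ((Restr R A `` {x}) // Restr S A)"
      by eventually_elim (use fin in blast)
    with nAE show False ..
  qed
  then obtain k where k: "0 < prob (B k)" ..
  show thesis
  proof (rule that[OF B k])
    fix Y assume Y: "Y \<subseteq> B k" "k < card Y" and YR: "\<And>y z. y \<in> Y \<Longrightarrow> z \<in> Y \<Longrightarrow> (y, z) \<in> R"
    from Y(2) have "finite Y" by (simp add: card_ge_0_finite)
    from Y(2) obtain Y' where Y': "Y' \<subseteq> Y" "card Y' = Suc k"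
      by (meson Suc_leI obtain_subset_with_card_n)
    then have "Y' \<noteq> {}" by auto
    then obtain x where x: "x \<in> Y'" by blast
    \<comment> \<open>The points of \<open>Y'\<close> are addressed from a base point
      \<open>x\<close> among them, which guarantees that \<open>x\<close> lies in
      \<open>B k\<close>.\<close>
    define q where "q y = (SOME g. g \<in> carrier G \<and> y = \<phi> g x)" for y
    have q: "q y \<in> carrier G \<and> y = \<phi> (q y) x" if "y \<in> Y'" for y
      unfolding q_def
      by (rule someI_ex) (use YR[of x y] x that Y' in \<open>auto simp: mem_R_iff\<close>)
    have "inj_on q Y'"
      by (rule inj_onI) (metis q)
    then have "q ` Y' \<in> T k"
      using q Y' finite_subset[OF Y'(1) \<open>finite Y\<close>] by (auto simp: T_def card_image)
    moreover have "x \<in> B k" using x Y Y' by blast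
    ultimately have "x \<notin> spread (q ` Y')" by (auto simp: B_def)
    moreover have "\<phi> (q y) x \<in> A" if "y \<in> Y'" for y
      using q[OF that] that Y Y' by (auto simp: B_def)
    ultimately obtain y z where yz: "y \<in> Y'" "z \<in> Y'" "q y \<noteq> q z" "(\<phi> (q y) x, \<phi> (q z) x) \<in> S"
      by (auto simp: spread_def)
    then have "y \<noteq> z" "(y, z) \<in> S" using q by auto
    with yz Y' show "\<exists>y\<in>Y. \<exists>z\<in>Y. y \<noteq> z \<and> (y, z) \<in> S" by blast
  qed
qed

text \<open>Bounded index on \<open>C\<close> yields, for every \<open>T\<close>, off-diagonal pairs
  \<open>(\<phi> g x, \<phi> h x)\<close> of the moved relation with \<open>g\<close>,
  \<open>h\<close> in a fixed finite set, with probability at least \<open>\<delta>\<close>. The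
  laws of these pairs are absolutely continuous with respect to \<open>m\<close>, so they cannot hit
  a set of small \<open>m\<close>-measure that often.\<close>

lemma everywhere_infinite_index_if_accumulates_at_Id:
  assumes ap: "aperiodic \<mu> R" and sub: "Borel_subrel \<mu> R S"
    and m: "finite_measure m" "equivalent_measures m MR"
    and acc: "\<And>r. 0 < r \<Longrightarrow> \<exists>T\<in>Aut_rel \<mu> R. measure m (map_prod T T ` S \<inter> R - Id) < r"
  shows "everywhere_infinite_index \<mu> R S"
proof (rule ccontr)
  assume "\<not> everywhere_infinite_index \<mu> R S"
  from this sub obtain C k where C: "C \<in> sets \<mu>" "0 < prob C"
    and Ck: "\<And>Y. Y \<subseteq> C \<Longrightarrow> k < card Y \<Longrightarrow> (\<And>y z. y \<in> Y \<Longrightarrow> z \<in> Y \<Longrightarrow> (y, z) \<in> R) \<Longrightarrow>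
      \<exists>y\<in>Y. \<exists>z\<in>Y. y \<noteq> z \<and> (y, z) \<in> S"
    by (rule finite_index_set) blast
  from ap C(2) obtain F \<delta> where F: "finite F" "F \<subseteq> carrier G" and "0 < \<delta>"
    and rec: "\<And>C'. C' \<in> sets \<mu> \<Longrightarrow> prob C \<le> prob C' \<Longrightarrow>
      \<delta> \<le> prob {x. k < card {g \<in> F. x \<in> first g \<inter> \<phi> g -` C'}}"
    by (rule uniform_recurrence[where k = k]) blast
  have sets_m: "sets m = sets MR" and null_m: "null_sets m \<subseteq> null_sets MR"
    using m(2) by (auto simp: equivalent_measures_def absolutely_continuous_def)
  \<comment> \<open>Small enough that the events \<open>B p\<close>, one for each pair in
    \<open>F \<times> F\<close>, cannot add up to \<open>\<delta>\<close>; the added 1 makes this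
    strict.\<close>
  define e where "e = \<delta> / (real (card (F \<times> F)) + 1)"
  have "0 < e" using \<open>0 < \<delta>\<close> by (simp add: e_def)
  have pair_meas: "(\<lambda>x. (\<phi> g x, \<phi> h x)) \<in> measurable \<mu> MR"
    if "g \<in> carrier G" "h \<in> carrier G" for g h
  proof (rule measurableI)
    show "(\<phi> g x, \<phi> h x) \<in> space MR" for x
      using act_act_mem_R[OF that] by (simp add: rel_measure_def space_measure_of_conv)
    show "(\<lambda>x. (\<phi> g x, \<phi> h x)) -` K \<inter> space \<mu> \<in> sets \<mu>" if K: "K \<in> sets MR" for K
      using rel_vimage_sets[of K "\<phi> g" "\<phi> h"] K that \<open>g \<in> carrier G\<close> \<open>h \<in> carrier G\<close> measurable_act
      by (simp add: sets_rel_measure vimage_def)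
  qed
  have small: "\<forall>\<^sub>F d in at_right 0. \<forall>K\<in>sets m. measure m K < d \<longrightarrow>
      measure (distr \<mu> MR (\<lambda>x. (\<phi> g x, \<phi> h x))) K < e" if "g \<in> F" "h \<in> F" for g h
  proof (rule absolutely_continuous_eventually_small[OF m(1)])
    have gh: "g \<in> carrier G" "h \<in> carrier G" using that F by auto
    note pm = pair_meas[OF gh]
    show "finite_measure (distr \<mu> MR (\<lambda>x. (\<phi> g x, \<phi> h x)))"
      by (rule finite_measure_distr[OF pm])
    \<comment> \<open>An \<open>m\<close>-null \<open>K\<close> has empty sections at almost every
      point, hence at almost every \<open>\<phi> g x\<close>, because \<open>\<phi> g\<close>
      preserves \<open>\<mu>\<close>.\<close>
    show "absolutely_continuous m (distr \<mu> MR (\<lambda>x. (\<phi> g x, \<phi> h x)))"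
      unfolding absolutely_continuous_def
    proof
      fix K assume "K \<in> null_sets m"
      then have "K \<in> null_sets MR" using null_m by blast
      then have K: "K \<in> sets MR" "AE x in \<mu>. K `` {x} = {}"
        using null_sets_rel_iff[of K] by auto
      have "AE x in \<mu>. x \<notin> (\<lambda>x. (\<phi> g x, \<phi> h x)) -` K \<inter> space \<mu>"
        using AE_act[OF gh(1) K(2)] by eventually_elim auto
      then show "K \<in> null_sets (distr \<mu> MR (\<lambda>x. (\<phi> g x, \<phi> h x)))"
        using measurable_sets[OF pm K(1)] K(1)
        by (subst null_sets_distr_iff[OF pm]) (simp add: AE_iff_null_sets)
    qed
  qed (simp_all add: sets_m \<open>0 < e\<close>)
  have "\<forall>\<^sub>F d in at_right 0. \<forall>p\<in>F \<times> F. \<forall>K\<in>sets m. measure m K < d \<longrightarrow>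
      measure (distr \<mu> MR (\<lambda>x. (\<phi> (fst p) x, \<phi> (snd p) x))) K < e"
    using F small by (intro eventually_ball_finite) auto
  then have "\<forall>\<^sub>F d in at_right (0::real). 0 < d \<and> (\<forall>p\<in>F \<times> F. \<forall>K\<in>sets m. measure m K < d \<longrightarrow>
      measure (distr \<mu> MR (\<lambda>x. (\<phi> (fst p) x, \<phi> (snd p) x))) K < e)"
    by (intro eventually_conj eventually_at_right_less)
  from eventually_happens'[OF trivial_limit_at_right_real this] obtain d :: real where "0 < d"
    and d: "\<And>p K. p \<in> F \<times> F \<Longrightarrow> K \<in> sets m \<Longrightarrow> measure m K < d \<Longrightarrow>
      measure (distr \<mu> MR (\<lambda>x. (\<phi> (fst p) x, \<phi> (snd p) x))) K < e"
    by blast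
  from acc[OF \<open>0 < d\<close>] obtain T where T: "T \<in> Aut_rel \<mu> R"
    and "measure m (map_prod T T ` S \<inter> R - Id) < d" by blast
  define K where "K = map_prod T T ` S \<inter> R - Id"
  have T_Aut: "T \<in> Aut_space \<mu>" using T by (simp add: Aut_rel_def)
  then have bij: "bij T" by (simp add: Aut_space_def)
  have K: "K \<in> sets MR"
    unfolding K_def using T_Aut sub Id_sets_rel by (intro sets.Diff sets_rel_map_prod_image)
  define B where "B p = {x. (\<phi> (fst p) x, \<phi> (snd p) x) \<in> K}" for p
  have B: "B p \<in> sets \<mu>" "prob (B p) < e" if "p \<in> F \<times> F" for p
  proof -
    have pm: "(\<lambda>x. (\<phi> (fst p) x, \<phi> (snd p) x)) \<in> measurable \<mu> MR"
      using that F by (intro pair_meas) auto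
    show "B p \<in> sets \<mu>"
      using measurable_sets[OF pm K] by (simp add: B_def vimage_def)
    show "prob (B p) < e"
      using d[OF that, of K] K \<open>measure m (map_prod T T ` S \<inter> R - Id) < d\<close>
      by (simp add: sets_m K_def[symmetric] measure_distr[OF pm K]) (simp add: B_def vimage_def)
  qed
  \<comment> \<open>The image of \<open>C\<close> under \<open>T\<close>, written as a preimage for
    measurability. It has the measure of \<open>C\<close>, so \<open>rec\<close> applies with a
    \<open>\<delta>\<close> fixed before \<open>T\<close>.\<close>
  define C' where "C' = inv_into UNIV T -` C"
  have C': "C' \<in> sets \<mu>"
    unfolding C'_def using T_Aut C by (intro measurable_vimage) (auto simp: Aut_space_def)
  have "T -` C' = C"
    unfolding C'_def using inv_f_f[OF bij_is_inj[OF bij]] by auto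
  then have "emeasure \<mu> C' = emeasure \<mu> C"
    using emeasure_distr[of T \<mu> \<mu> C'] C' T_Aut by (simp add: Aut_space_def)
  then have "prob C \<le> prob C'" by (simp add: measure_def)
  with rec C' have \<delta>: "\<delta> \<le> prob {x. k < card {g \<in> F. x \<in> first g \<inter> \<phi> g -` C'}}" by blast
  \<comment> \<open>\<open>T\<close> preserves \<open>R\<close> only up to null sets: for almost
    every \<open>x\<close>, the inverse of \<open>T\<close> maps the whole class of \<open>x\<close>
    into a single class.\<close>
  have "AE x in \<mu>. (R - map_prod T T ` R) `` {x} = {}"
  proof -
    have "section_integral \<mu> (R - map_prod T T ` R) \<le> section_integral \<mu> (sym_diff (map_prod T T ` R) R)"
      unfolding section_integral_def by (intro nn_integral_mono emeasure_mono) auto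
    also have "\<dots> = 0" using T by (simp add: Aut_rel_def)
    finally have 0: "section_integral \<mu> (R - map_prod T T ` R) = 0" by simp
    have "R - map_prod T T ` R \<in> sets MR"
      using map_prod_image_sets[OF T_Aut R_sets] R_sets by (auto simp: sets_rel_measure)
    with 0 show ?thesis
      using null_sets_rel_iff emeasure_rel by (simp add: null_sets_def)
  qed
  then have "AE x in \<mu>. x \<in> {x. k < card {g \<in> F. x \<in> first g \<inter> \<phi> g -` C'}} \<longrightarrow> x \<in> (\<Union>p\<in>F \<times> F. B p)"
  proof eventually_elim
    case (elim x)
    show ?case
    proof
      assume "x \<in> {x. k < card {g \<in> F. x \<in> first g \<inter> \<phi> g -` C'}}"
      moreover define I where "I = {g \<in> F. x \<in> first g \<inter> \<phi> g -` C'}"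
      ultimately have "k < card I" by simp
      have I: "g \<in> carrier G" "g \<in> F" "x \<in> first g" "inv_into UNIV T (\<phi> g x) \<in> C" if "g \<in> I" for g
        using that F by (auto simp: I_def C'_def)
      \<comment> \<open>The finite index bound on \<open>C\<close> is applied to these points; they
        are distinct since \<open>first\<close> separates the \<open>\<phi> g x\<close> and the
        inverse of \<open>T\<close> is injective.\<close>
      define t where "t g = inv_into UNIV T (\<phi> g x)" for g
      have inj_T: "inj (inv_into UNIV T)"
        by (rule bij_is_inj[OF bij_imp_bij_inv[OF bij]])
      have "inj_on t I"
        using I first_unique unfolding t_def by (intro inj_onI) (metis injD[OF inj_T])
      then have "k < card (t ` I)" using \<open>k < card I\<close> by (simp add: card_image)
      moreover have "t ` I \<subseteq> C" using I by (auto simp: t_def)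
      moreover have "(inv_into UNIV T x, t g) \<in> R" if "g \<in> I" for g
        using elim act_mem_R[OF I(1)[OF that], of x]
        unfolding t_def mem_map_prod_image_iff[OF bij, symmetric] by blast
      then have "(y, z) \<in> R" if "y \<in> t ` I" "z \<in> t ` I" for y z
        using that by (auto intro: R_trans[OF R_sym])
      ultimately obtain g h where gh: "g \<in> I" "h \<in> I" "t g \<noteq> t h" "(t g, t h) \<in> S"
        using Ck[of "t ` I"] by blast
      have "(\<phi> g x, \<phi> h x) \<in> map_prod T T ` S"
        using gh(4) by (simp add: t_def mem_map_prod_image_iff[OF bij] del: image_iff)
      moreover have "(\<phi> g x, \<phi> h x) \<in> R"
        using I(1) gh(1,2) by (intro act_act_mem_R)
      moreover have "\<phi> g x \<noteq> \<phi> h x" using gh(3) by (auto simp: t_def)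
      ultimately have "x \<in> B (g, h)" by (simp add: B_def K_def)
      then show "x \<in> (\<Union>p\<in>F \<times> F. B p)" using I(2) gh(1,2) by blast
    qed
  qed
  then have "prob {x. k < card {g \<in> F. x \<in> first g \<inter> \<phi> g -` C'}} \<le> prob (\<Union>p\<in>F \<times> F. B p)"
    using F B(1) by (intro finite_measure_mono_AE) (auto intro!: sets.finite_UN)
  also have "\<dots> \<le> (\<Sum>p\<in>F \<times> F. prob (B p))"
    using F B(1) by (intro finite_measure_subadditive_finite) auto
  also have "\<dots> \<le> (\<Sum>p\<in>F \<times> F. e)"
    using B(2) by (intro sum_mono) (auto intro: less_imp_le)
  also have "\<dots> = real (card (F \<times> F)) * e" by simp
  also have "\<dots> < \<delta>"
    using \<open>0 < \<delta>\<close> by (simp add: e_def field_simps)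
  finally show False using \<delta> by simp
qed

end

theorem theorem3:
  fixes \<mu> :: "'a::polish_space measure"
    and R S :: "('a \<times> 'a) set"
    and m :: "('a \<times> 'a) measure"
  assumes "standard_prob_space \<mu>"
    and "pmp_equiv_rel \<mu> R"
    and "aperiodic \<mu> R"
    and "Borel_subrel \<mu> R S"
    and "finite_measure m"
    and "equivalent_measures m (rel_measure \<mu> R)"
  shows "(everywhere_infinite_index \<mu> R S \<longleftrightarrow>
            mclass (rel_measure \<mu> R) Id
              \<in> Sub_topology \<mu> R m closure_of rel_orbit \<mu> R (full_group \<mu> R) S) \<and>
         (mclass (rel_measure \<mu> R) Id
              \<in> Sub_topology \<mu> R m closure_of rel_orbit \<mu> R (full_group \<mu> R) S \<longleftrightarrow>
            mclass (rel_measure \<mu> R) Id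
              \<in> Sub_topology \<mu> R m closure_of rel_orbit \<mu> R (Aut_rel \<mu> R) S)"
proof -
  from assms(2) obtain G :: "nat monoid" and \<phi> where G: "group_action G (UNIV :: 'a set) \<phi>"
    "\<And>g. g \<in> carrier G \<Longrightarrow> \<phi> g \<in> measurable \<mu> \<mu>" "\<And>g. g \<in> carrier G \<Longrightarrow> distr \<mu> \<mu> (\<phi> g) = \<mu>"
    and R: "R = {(x, y). y \<in> orbit G \<phi> x}"
    by (auto simp: pmp_equiv_rel_def)
  interpret pmp_action \<mu> G \<phi>
    using assms(1) G unfolding pmp_action_def pmp_action_axioms_def standard_prob_space_def by blast
  have R_eq: "R = pmp_action.R G \<phi>"
    using R by (simp add: R_def)
  note assms = assms(3-)[unfolded R_eq]
  \<comment> \<open>The inclusion of the full group in \<open>Aut_rel \<mu> R\<close> carries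
    accumulation from the smaller orbit to the larger, closing the cycle of implications.\<close>
  have "full_group \<mu> R \<subseteq> Aut_rel \<mu> R" "Aut_rel \<mu> R \<subseteq> Aut_space \<mu>"
    by (auto simp: full_group_def Aut_rel_def)
  then show ?thesis
    using full_group_orbit_accumulates_at_Id[OF _ assms(2-4)]
      everywhere_infinite_index_if_accumulates_at_Id[OF assms(1-4)]
      mem_closure_rel_orbit_iff[OF assms(3,4) _ assms(2)]
    unfolding R_eq by (meson order_trans subsetD)
qed

end
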